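(* Let $d=1$, and let $a_{per},c_{per}:\mathbb{R}\to\mathbb{R}$ be $\mathbb{Z}$-periodic measurable functions for which there exist $0<\alpha\le\beta$ such that $\alpha\le a_{per}\le\beta$ and $\alpha\le a_{per}+c_{per}\le\beta$ almost everywhere. For $\eta\in[0,1]$, let $a_\eta^*$ be the homogenized coefficient of the random medium $a_\eta=a_{per}+b_\eta c_{per}$, and let $a_{per}^*$ be the homogenized coefficient of $a_{per}$; let $a_1^{*,N}$ and $a_2^{*,N}$ ($N$ odd positive integer) be the one-defect and two-defect corrections (all defined in the context). Then the limits $\bar a_1^*=\lim_{N\to\infty}a_1^{*,N}$ and $\bar a_2^*=\lim_{N\to\infty}a_2^{*,N}$ exist and, as $\eta\to0$, $$a_\eta^*=a_{per}^*+\eta\,\bar a_1^*+\eta^2\,\bar a_2^*+\mathcal{O}(\eta^3).$$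
   Context: Random medium: $b_\eta(x,\omega)=\sum_{k\in\mathbb{Z}}\mathbf{1}_{[k-\frac12,k+\frac12]}(x)\,B_\eta^k(\omega)$, where the $B_\eta^k$, $k\in\mathbb{Z}$, are independent Bernoulli random variables with parameter $\eta$ (equal to $1$ with probability $\eta$ and to $0$ with probability $1-\eta$). In dimension one the homogenized coefficients are given by the explicit expressions $$a_{per}^*=\left(\int_{-1/2}^{1/2}\frac{1}{a_{per}}\right)^{-1},\qquad a_\eta^*=\left(\mathbb{E}\int_{-1/2}^{1/2}\frac{1}{a_{per}+b_\eta c_{per}}\right)^{-1}.$$ For $N$ an odd positive integer, set $I_N=[-\frac N2,\frac N2]$ and $\mathcal{T}_N=\{-\frac{N-1}2,\dots,\frac{N-1}2\}$. For $k\in\mathcal{T}_N$, $k\ne0$, set $$a_1^0=a_{per}+\mathbf{1}_{[-\frac12,\frac12]}c_{per},\qquad a_2^{0,k}=a_{per}+\mathbf{1}_{[-\frac12,\frac12]\cup[k-\frac12,k+\frac12]}c_{per}.$$ Let $w^0$, $w^{1,0,N}$, $w^{2,0,k,N}$ be the (unique up to additive constants) weak solutions of $$-\frac{d}{dx}\left(a_{per}\left(\tfrac{d}{dx}w^0+1\right)\right)=0,\quad w^0\ 1\text{-periodic};$$ $$-\frac{d}{dx}\left(a_1^0\left(\tfrac{d}{dx}w^{1,0,N}+1\right)\right)=0\ \text{in } I_N,\quad w^{1,0,N}\ N\text{-periodic};$$ $$-\frac{d}{dx}\left(a_2^{0,k}\left(\tfrac{d}{dx}w^{2,0,k,N}+1\right)\right)=0\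 \text{in } I_N,\quad w^{2,0,k,N}\ N\text{-periodic}.$$ The corrections are $$a_1^{*,N}=\int_{I_N}a_1^0\left(\tfrac{d}{dx}w^{1,0,N}+1\right)-\int_{I_N}a_{per}\left(\tfrac{d}{dx}w^0+1\right),$$ $$a_2^{*,N}=\frac12\sum_{k\in\mathcal{T}_N,\,k\ne0}\left(\int_{I_N}a_2^{0,k}\left(\tfrac{d}{dx}w^{2,0,k,N}+1\right)-2\int_{I_N}a_1^0\left(\tfrac{d}{dx}w^{1,0,N}+1\right)+\int_{I_N}a_{per}\left(\tfrac{d}{dx}w^0+1\right)\right).$$ *)

theory Defs
  imports "HOL-Probability.Probability" "HOL-Library.Landau_Symbols"
begin

section \<open>Periodic Sobolev functions on the line\<close>

definition locally_integrable :: "(real \<Rightarrow> real) \<Rightarrow> bool" where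
  "locally_integrable f \<longleftrightarrow> (\<forall>r. set_integrable lebesgue {-r..r} f)"

definition locally_L2 :: "(real \<Rightarrow> real) \<Rightarrow> bool" where
  "locally_L2 f \<longleftrightarrow> f \<in> borel_measurable lebesgue \<and> locally_integrable (\<lambda>x. (f x)\<^sup>2)"

definition test_function :: "(real \<Rightarrow> real) \<Rightarrow> bool" where
  "test_function \<phi> \<longleftrightarrow> \<phi> C1_differentiable_on UNIV \<and> compact (closure {x. \<phi> x \<noteq> 0})"

definition has_weak_deriv :: "(real \<Rightarrow> real) \<Rightarrow> (real \<Rightarrow> real) \<Rightarrow> bool" where
  "has_weak_deriv w g \<longleftrightarrow> locally_integrable w \<and> locally_integrable g \<and>
     (\<forall>\<phi>. test_function \<phi> \<longrightarrow>
        (LINT x|lebesgue. w x * deriv \<phi> x) = - (LINT x|lebesgue. g x * \<phi> x))"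

(* A representative of the weak derivative, which is only determined almost everywhere. *)
definition weak_deriv :: "(real \<Rightarrow> real) \<Rightarrow> real \<Rightarrow> real" where
  "weak_deriv w = (SOME g. has_weak_deriv w g)"

definition periodic_H1 :: "nat \<Rightarrow> (real \<Rightarrow> real) \<Rightarrow> bool" where
  "periodic_H1 N w \<longleftrightarrow> (\<forall>x. w (x + real N) = w x) \<and> locally_L2 w \<and>
     (\<exists>g. has_weak_deriv w g \<and> locally_L2 g)"

section \<open>Correctors\<close>

definition cell :: "nat \<Rightarrow> real set" where
  "cell N = {- (real N / 2) .. real N / 2}"

(* Variational form of -(a (w' + 1))' = 0 in cell N with w N-periodic: only the values of a
   on cell N enter, so a itself need not be N-periodic. *)
definition is_corrector :: "(real \<Rightarrow> real) \<Rightarrow> nat \<Rightarrow> (real \<Rightarrow> real) \<Rightarrow> bool" where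
  "is_corrector a N w \<longleftrightarrow> periodic_H1 N w \<and>
     (\<forall>v. periodic_H1 N v \<longrightarrow>
        (LINT x:cell N|lebesgue. a x * (weak_deriv w x + 1) * weak_deriv v x) = 0)"

(* Correctors are unique only up to additive constants, which the choice fixes arbitrarily. *)
definition corrector :: "(real \<Rightarrow> real) \<Rightarrow> nat \<Rightarrow> real \<Rightarrow> real" where
  "corrector a N = (SOME w. is_corrector a N w)"

section \<open>Defects\<close>

definition one_defect :: "(real \<Rightarrow> real) \<Rightarrow> (real \<Rightarrow> real) \<Rightarrow> real \<Rightarrow> real" where
  "one_defect a c x = a x + indicator {-1/2..1/2} x * c x"

definition two_defects :: "(real \<Rightarrow> real) \<Rightarrow> (real \<Rightarrow> real) \<Rightarrow> int \<Rightarrow> real \<Rightarrow> real" where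
  "two_defects a c k x =
     a x + indicator ({-1/2..1/2} \<union> {of_int k - 1/2 .. of_int k + 1/2}) x * c x"

definition flux0 :: "(real \<Rightarrow> real) \<Rightarrow> nat \<Rightarrow> real" where
  "flux0 a N = (LINT x:cell N|lebesgue. a x * (weak_deriv (corrector a 1) x + 1))"

definition flux1 :: "(real \<Rightarrow> real) \<Rightarrow> (real \<Rightarrow> real) \<Rightarrow> nat \<Rightarrow> real" where
  "flux1 a c N = (LINT x:cell N|lebesgue.
     one_defect a c x * (weak_deriv (corrector (one_defect a c) N) x + 1))"

definition flux2 :: "(real \<Rightarrow> real) \<Rightarrow> (real \<Rightarrow> real) \<Rightarrow> int \<Rightarrow> nat \<Rightarrow> real" where
  "flux2 a c k N = (LINT x:cell N|lebesgue.
     two_defects a c k x * (weak_deriv (corrector (two_defects a c k) N) x + 1))"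

(* The site set T_N; meant for odd N. *)
definition sites :: "nat \<Rightarrow> int set" where
  "sites N = {- ((int N - 1) div 2) .. (int N - 1) div 2}"

definition first_correction :: "(real \<Rightarrow> real) \<Rightarrow> (real \<Rightarrow> real) \<Rightarrow> nat \<Rightarrow> real" where
  "first_correction a c N = flux1 a c N - flux0 a N"

definition second_correction :: "(real \<Rightarrow> real) \<Rightarrow> (real \<Rightarrow> real) \<Rightarrow> nat \<Rightarrow> real" where
  "second_correction a c N =
     1 / 2 * (\<Sum>k\<in>sites N - {0}. (flux2 a c k N - 2 * flux1 a c N + flux0 a N))"

section \<open>The random medium and homogenized coefficients\<close>

definition bernoulli_family :: "'a measure \<Rightarrow> real \<Rightarrow> (int \<Rightarrow> 'a \<Rightarrow> real) \<Rightarrow> bool" where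
  "bernoulli_family M p B \<longleftrightarrow> prob_space M \<and> prob_space.indep_vars M (\<lambda>_. borel) B UNIV \<and>
     (\<forall>k. measure M {\<omega> \<in> space M. B k \<omega> = 1} = p \<and>
          measure M {\<omega> \<in> space M. B k \<omega> = 0} = 1 - p)"

(* For each x at most two terms of the sum are nonzero. *)
definition random_defects :: "(int \<Rightarrow> 'a \<Rightarrow> real) \<Rightarrow> real \<Rightarrow> 'a \<Rightarrow> real" where
  "random_defects B x \<omega> =
     (\<Sum>\<^sub>\<infinity>k\<in>UNIV. indicator {of_int k - 1/2 .. of_int k + 1/2} x * B k \<omega>)"

definition hom_periodic :: "(real \<Rightarrow> real) \<Rightarrow> real" where
  "hom_periodic a = inverse (LINT x:{-1/2..1/2}|lebesgue. 1 / a x)"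

definition hom_random ::
  "'a measure \<Rightarrow> (int \<Rightarrow> 'a \<Rightarrow> real) \<Rightarrow> (real \<Rightarrow> real) \<Rightarrow> (real \<Rightarrow> real) \<Rightarrow> real" where
  "hom_random M B a c = inverse (LINT \<omega>|M. (LINT x:{-1/2..1/2}|lebesgue.
     1 / (a x + random_defects B x \<omega> * c x)))"

end

theory Submission
  imports Defs "HOL-Real_Asymp.Real_Asymp"
begin

text \<open>In dimension one the flux \<open>A (w' + 1)\<close> of a corrector is constant, so its integral over a cell of
  length \<open>N\<close> is \<open>N\<^sup>2 / \<integral> 1 / A\<close>. With \<open>P = \<integral> 1 / a\<close> and \<open>Q = \<integral> 1 / (a + c)\<close> over the unit cell and
  \<open>D = P - Q\<close>, a medium with \<open>j\<close> defects has \<open>\<integral> 1 / A = N P - j D\<close>, and the corrections converge to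
  \<open>D / P\<^sup>2\<close> and \<open>D\<^sup>2 / P\<^sup>3\<close>. These are the Taylor coefficients at \<open>0\<close> of the random coefficient
  \<open>1 / (P - \<eta> D)\<close>.\<close>

section \<open>Local integrability on the line\<close>

text \<open>Correctors and weak derivatives are arbitrary choices by \<open>SOME\<close>, the latter
  fixed only up to null sets. Three facts replace it: weak derivatives are unique almost everywhere,
  the weak derivative of a periodic function has mean zero over a period, and a bounded mean-free
  periodic function has a periodic primitive with that function as weak derivative. The limits come
  from expanding the flux in 1/N: N^2/(N P - j D) = N/P + j D/P^2 + j^2 D^2/(N P^3) + ... . The
  first difference in j leaves D/P^2. The second difference cancels the first two terms and is 2
  D^2/(N P^3) to leading order; the factor 1/2 and the N - 1 nonzero sites turn this into D^2/P^3.
  Odd lengths are written \<open>2 * m + 1\<close>, so that a cell is a union of unit intervals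
  centred at integers.\<close>

lemma borel_measurable_lebesgue_indicator_Icc [measurable]:
  "(indicator {l..r::real} :: real \<Rightarrow> real) \<in> borel_measurable lebesgue"
  by (rule borel_measurable_indicator) simp

lemma set_integrable_const_Icc: "set_integrable lebesgue {l..r::real} (\<lambda>_. C :: real)"
  unfolding set_integrable_def
  by (intro integrable_scaleR_left integrable_real_indicator) (simp_all add: emeasure_lborel_Icc_eq)

lemma lebesgue_integral_shift:
  fixes f :: "real \<Rightarrow> real"
  shows "(LINT x|lebesgue. f (x + s)) = (LINT x|lebesgue. f x)"
  using lebesgue_integral_real_affine[of 1 f s] by (simp add: add.commute)

lemma set_lebesgue_integral_shift:
  fixes f :: "real \<Rightarrow> real"
  shows "(LINT x:{l + s..r + s}|lebesgue. f x) = (LINT x:{l..r}|lebesgue. f (x + s))"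
proof -
  have "indicator {l..r} x = (indicator {l + s..r + s} (x + s) :: real)" for x
    by (simp add: indicator_def)
  then show ?thesis
    using lebesgue_integral_shift[of "\<lambda>x. indicator {l + s..r + s} x *\<^sub>R f x" s]
    by (simp add: set_lebesgue_integral_def)
qed

lemma borel_measurable_lebesgue_shift:
  fixes f :: "real \<Rightarrow> real"
  assumes "f \<in> borel_measurable lebesgue"
  shows "(\<lambda>x. f (x + s)) \<in> borel_measurable lebesgue"
proof -
  have "(\<lambda>x::real. s + (\<Sum>j\<in>Basis. (1 * (x \<bullet> j)) *\<^sub>R j)) \<in> lebesgue \<rightarrow>\<^sub>M lebesgue"
    by (rule lebesgue_affine_measurable) auto
  then have "(\<lambda>x::real. x + s) \<in> lebesgue \<rightarrow>\<^sub>M lebesgue"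
    by (simp add: add.commute)
  then show ?thesis
    using assms by (rule measurable_compose)
qed

lemma locally_integrable_Icc:
  assumes "locally_integrable f"
  shows "set_integrable lebesgue {l..r} f"
proof (rule set_integrable_subset)
  show "set_integrable lebesgue {- max (- l) r..max (- l) r} f"
    using assms by (simp add: locally_integrable_def)
qed auto

text \<open>Local integrability only concerns truncations of \<open>f\<close> to bounded intervals;
  \<open>f\<close> is their pointwise limit.\<close>

lemma locally_integrable_borel_measurable:
  assumes "locally_integrable f"
  shows "f \<in> borel_measurable lebesgue"
proof (rule borel_measurable_LIMSEQ_real)
  show "(\<lambda>x. indicator {- real n..real n} x *\<^sub>R f x) \<in> borel_measurable lebesgue" for n
    using locally_integrable_Icc[OF assms]
    by (auto simp: set_integrable_def dest: borel_measurable_integrable)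
  fix x :: real
  obtain n0 :: nat where "\<bar>x\<bar> \<le> real n0" using real_arch_simple by blast
  then have "eventually (\<lambda>n. indicator {- real n..real n} x *\<^sub>R f x = f x) sequentially"
    by (intro eventually_sequentiallyI[of n0]) (auto simp: indicator_def)
  then show "(\<lambda>n. indicator {- real n..real n} x *\<^sub>R f x) \<longlonglongrightarrow> f x"
    by (rule tendsto_eventually)
qed

lemma integrable_mult_compact_support:
  fixes f h :: "real \<Rightarrow> real"
  assumes f: "locally_integrable f" and h: "h \<in> borel_measurable lebesgue"
    and bound: "\<And>x. \<bar>h x\<bar> \<le> K" and supp: "\<And>x. x \<notin> {l..r} \<Longrightarrow> h x = 0"
  shows "integrable lebesgue (\<lambda>x. f x * h x)"
proof (rule Bochner_Integration.integrable_bound)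
  show "integrable lebesgue (\<lambda>x. K * (indicator {l..r} x *\<^sub>R f x))"
    using locally_integrable_Icc[OF f, of l r] by (simp add: set_integrable_def)
  show "(\<lambda>x. f x * h x) \<in> borel_measurable lebesgue"
    using locally_integrable_borel_measurable[OF f] h by simp
  have "\<bar>f x * h x\<bar> \<le> \<bar>K * (indicator {l..r} x *\<^sub>R f x)\<bar>" for x
  proof (cases "x \<in> {l..r}")
    case True
    have "\<bar>f x\<bar> * \<bar>h x\<bar> \<le> \<bar>f x\<bar> * \<bar>K\<bar>"
      using bound[of x] by (intro mult_left_mono) auto
    then show ?thesis using True by (simp add: abs_mult mult.commute)
  qed (simp add: supp)
  then show "AE x in lebesgue. norm (f x * h x) \<le> norm (K * (indicator {l..r} x *\<^sub>R f x))"
    by simp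
qed

lemma locally_integrable_bounded:
  assumes "f \<in> borel_measurable lebesgue" and "\<And>r. \<exists>K. \<forall>x\<in>{-r..r}. \<bar>f x\<bar> \<le> K"
  shows "locally_integrable f"
  unfolding locally_integrable_def
proof
  fix r :: real
  obtain K where K: "\<And>x. x \<in> {-r..r} \<Longrightarrow> \<bar>f x\<bar> \<le> K" using assms(2) by blast
  show "set_integrable lebesgue {-r..r} f"
    unfolding set_integrable_def
  proof (rule Bochner_Integration.integrable_bound)
    show "integrable lebesgue (\<lambda>x. indicator {-r..r} x * K)"
      by (intro integrable_mult_left integrable_real_indicator) (simp_all add: emeasure_lborel_Icc_eq)
    show "AE x in lebesgue. norm (indicat_real {-r..r} x *\<^sub>R f x) \<le> norm (indicat_real {-r..r} x * K)"
      using K by (intro AE_I2) (force simp: indicator_def)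
      show "(\<lambda>x. indicator {-r..r} x *\<^sub>R f x) \<in> borel_measurable lebesgue"
      using assms(1) by measurable
  qed
qed

text \<open>Intervals generate the Borel sets, so vanishing on intervals propagates to all Borel
  sets, and a density is determined almost everywhere by its set integrals. The argument runs on a
  Borel version \<open>g'\<close> of \<open>g\<close>, truncated to bounded intervals because
  uniqueness of densities needs an integrable function.\<close>

lemma AE_zero_of_interval_integrals_zero:
  assumes g: "locally_integrable g"
    and zero: "\<And>l r. l \<le> r \<Longrightarrow> (LINT x:{l..r}|lebesgue. g x) = 0"
  shows "AE x in lebesgue. g x = 0"
proof -
  \<comment> \<open>The intersections of intervals formed below may be empty, that is, have
    \<open>l > r\<close>.\<close>
  have zero': "(LINT x:{l..r}|lebesgue. g x) = 0" for l r
    using zero[of l r] by (cases "l \<le> r") (auto simp: set_lebesgue_integral_def)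
  obtain g' where g'[measurable]: "g' \<in> borel_measurable lborel" and ae: "AE x in lborel. g x = g' x"
    using completion_ex_borel_measurable_real[OF locally_integrable_borel_measurable[OF g]] by auto
  have ae': "AE x in lebesgue. g x = g' x" using ae by (rule AE_completion)
  have gm[measurable]: "g \<in> borel_measurable lebesgue"
    using locally_integrable_borel_measurable[OF g] .
  have g'm[measurable]: "g' \<in> borel_measurable lebesgue" using g' by (rule measurable_completion)
  have "AE x in lborel. indicator {-real n..real n} x * g' x = 0" for n :: nat
  proof (rule density_unique_real)
    let ?h = "\<lambda>x. indicator {-real n..real n} x * g' x"
    have [measurable]: "?h \<in> borel_measurable lborel" by measurable
    have "set_integrable lebesgue {-real n..real n} g'"
      using locally_integrable_Icc[OF g, of "-real n" "real n"] ae'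
      by (subst set_integrable_cong_AE[where g = g]) auto
    then have "integrable lebesgue ?h" by (simp add: set_integrable_def)
    then show int: "integrable lborel ?h" by (subst (asm) integrable_completion) auto
    have inter: "set_lebesgue_integral lborel {l..r} ?h = 0" for l r
    proof -
      have "set_lebesgue_integral lborel {l..r} ?h
          = (LINT x|lebesgue. indicator {l..r} x *\<^sub>R ?h x)"
        by (simp add: set_lebesgue_integral_def integral_completion)
      also have "\<dots> = (LINT x|lebesgue. indicator {max l (-real n)..min r (real n)} x * g x)"
      proof (rule integral_cong_AE)
        show "AE x in lebesgue. indicator {l..r} x *\<^sub>R ?h x
            = indicator {max l (-real n)..min r (real n)} x * g x"
          using ae' by eventually_elim (auto simp: indicator_def)
      qed measurable
      also have "\<dots> = 0"
        using zero'[of "max l (-real n)" "min r (real n)"] by (simp add: set_lebesgue_integral_def)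
      finally show ?thesis .
    qed
    \<comment> \<open>The integral over the whole line is what the complement step of the induction
      subtracts from.\<close>
    have total: "integral\<^sup>L lborel ?h = 0"
    proof -
      have "integral\<^sup>L lborel ?h = set_lebesgue_integral lborel {-real n..real n} ?h"
        unfolding set_lebesgue_integral_def by (intro Bochner_Integration.integral_cong) (auto simp: indicator_def)
      then show ?thesis using inter by simp
    qed
    fix A :: "real set" assume "A \<in> sets lborel"
    then have "A \<in> sets borel" by simp
    then have "set_lebesgue_integral lborel A ?h = 0"
    proof (induction A rule: borel_set_induct)
      case (interval a b)
      then show ?case using inter by simp
    next
      case (compl A)
      have "set_lebesgue_integral lborel (A \<union> - A) ?h
          = set_lebesgue_integral lborel A ?h + set_lebesgue_integral lborel (- A) ?h"
        using compl.hyps int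
        by (intro set_integral_Un) (auto simp: set_integrable_def intro!: integrable_mult_indicator[where 'b = real, simplified])
      moreover have "set_lebesgue_integral lborel (A \<union> - A) ?h = 0"
        using total by (simp add: set_lebesgue_integral_def)
      ultimately show ?case using compl.IH by simp
    next
      case (union f)
      have "set_lebesgue_integral lborel (\<Union>i. f i) ?h = (\<Sum>i. set_lebesgue_integral lborel (f i) ?h)"
        using union.hyps int
        by (intro lebesgue_integral_countable_add)
          (auto simp: set_integrable_def disjoint_family_on_def intro!: integrable_mult_indicator[where 'b = real, simplified])
      then show ?case using union.IH by simp
    qed (simp add: set_lebesgue_integral_def)
    then show "set_lebesgue_integral lborel A ?h = set_lebesgue_integral lborel A (\<lambda>x. 0)"
      by simp
  qed simp
  then have "AE x in lborel. \<forall>n::nat. indicator {-real n..real n} x * g' x = 0"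
    by (rule AE_all_countable[THEN iffD2, OF allI])
  then have "AE x in lborel. g x = 0"
    using ae
  proof eventually_elim
    case (elim x)
    obtain n :: nat where "\<bar>x\<bar> \<le> real n" using real_arch_simple by blast
    then have "indicator {-real n..real n} x = (1::real)" by (auto simp: indicator_def)
    moreover have "indicator {-real n..real n} x * g' x = 0" using elim by blast
    ultimately show ?case using elim by simp
  qed
  then show ?thesis by (rule AE_completion)
qed

section \<open>Weak derivatives\<close>

definition pos_sq :: "real \<Rightarrow> real" where
  "pos_sq t = (max 0 t)\<^sup>2"

lemma pos_sq_deriv: "(pos_sq has_real_derivative 2 * max 0 t) (at t)"
proof -
  consider "t < 0" | "t = 0" | "t > 0" by linarith
  then show ?thesis
  proof cases
    case 1
    have "((\<lambda>_. 0) has_real_derivative 2 * max 0 t) (at t)" using 1 by simp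
    then show ?thesis
      by (rule has_field_derivative_transform_within_open[where S = "{..<0}"])
        (use 1 in \<open>auto simp: pos_sq_def\<close>)
  next
    case 2
    have "((\<lambda>h. max 0 h) \<longlongrightarrow> max 0 (0::real)) (at 0)" by (intro tendsto_intros)
    moreover have "pos_sq h / h = max 0 h" for h
      by (auto simp: pos_sq_def max_def power2_eq_square)
    ultimately have "((\<lambda>h. pos_sq h / h) \<longlongrightarrow> 0) (at 0)" by simp
    then show ?thesis using 2 by (simp add: DERIV_def pos_sq_def)
  next
    case 3
    have "((\<lambda>x. x\<^sup>2) has_real_derivative 2 * max 0 t) (at t)"
      using 3 by (auto intro!: derivative_eq_intros)
    then show ?thesis
      by (rule has_field_derivative_transform_within_open[where S = "{0<..}"])
        (use 3 in \<open>auto simp: pos_sq_def\<close>)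
  qed
qed

text \<open>The quadratic spline with knots 0, 1/2, 1 that climbs from 0 to 1; its second derivative
  is 4, then -4 between the knots and 0 outside. Its derivative is a tent of height 2. It is only
  C1, which is what \<open>test_function\<close> asks for.\<close>

definition smooth_step :: "real \<Rightarrow> real" where
  "smooth_step t = 2 * pos_sq t - 4 * pos_sq (t - 1/2) + 2 * pos_sq (t - 1)"

definition smooth_step' :: "real \<Rightarrow> real" where
  "smooth_step' t = 4 * max 0 t - 8 * max 0 (t - 1/2) + 4 * max 0 (t - 1)"

lemma smooth_step_deriv: "(smooth_step has_real_derivative smooth_step' t) (at t)"
  unfolding smooth_step_def smooth_step'_def
  by (auto intro!: derivative_eq_intros DERIV_chain2[OF pos_sq_deriv])

lemma smooth_step_le_0: "t \<le> 0 \<Longrightarrow> smooth_step t = 0"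
  by (simp add: smooth_step_def pos_sq_def)

lemma smooth_step_ge_1: "t \<ge> 1 \<Longrightarrow> smooth_step t = 1"
  by (simp add: smooth_step_def pos_sq_def power2_eq_square algebra_simps)

lemma smooth_step_bounds: "0 \<le> smooth_step t \<and> smooth_step t \<le> 1"
proof -
  consider "t \<le> 0" | "0 \<le> t" "t \<le> 1/2" | "1/2 \<le> t" "t \<le> 1" | "1 \<le> t" by linarith
  then show ?thesis
  proof cases
    case 2
    have "t * t \<le> (1/2) * (1/2)" using 2 by (intro mult_mono) auto
    then show ?thesis using 2 by (simp add: smooth_step_def pos_sq_def power2_eq_square)
  next
    case 3
    have "smooth_step t = 1 - 2 * (1 - t) * (1 - t)"
      using 3 by (simp add: smooth_step_def pos_sq_def power2_eq_square algebra_simps)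
    moreover have "(1 - t) * (1 - t) \<le> (1/2) * (1/2)" using 3 by (intro mult_mono) auto
    moreover have "0 \<le> (1 - t) * (1 - t)" by simp
    ultimately show ?thesis by linarith
  qed (simp_all add: smooth_step_le_0 smooth_step_ge_1)
qed

lemma smooth_step'_bounds: "\<bar>smooth_step' t\<bar> \<le> 2"
  by (auto simp: smooth_step'_def max_def)

lemma smooth_step'_outside: "t \<notin> {0..1} \<Longrightarrow> smooth_step' t = 0"
  by (auto simp: smooth_step'_def max_def)

lemma continuous_smooth_step': "continuous_on S smooth_step'"
  unfolding smooth_step'_def by (intro continuous_intros)

text \<open>A plateau whose two ramps have width \<open>1 / Suc n\<close> and start at
  \<open>l\<close> and \<open>r\<close>. Both ramps have the same shape, so they are translates of
  each other.\<close>

definition bump :: "real \<Rightarrow> real \<Rightarrow> nat \<Rightarrow> real \<Rightarrow> real" where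
  "bump l r n x = smooth_step (real (Suc n) * (x - l)) - smooth_step (real (Suc n) * (x - r))"

lemma bump_deriv:
  "(bump l r n has_real_derivative
     real (Suc n) * smooth_step' (real (Suc n) * (x - l))
       - real (Suc n) * smooth_step' (real (Suc n) * (x - r))) (at x)"
  unfolding bump_def
  by (auto intro!: derivative_eq_intros DERIV_chain2[OF smooth_step_deriv])

text \<open>Each ramp is at most 1 wide, so one support interval serves for all \<open>n\<close>;
  dominated convergence relies on this uniformity.\<close>

lemma bump_outside:
  assumes "l \<le> r" "x \<notin> {l..r + 1}"
  shows "bump l r n x = 0"
proof -
  consider "x < l" | "x > r + 1" using assms by auto
  then show ?thesis
  proof cases
    case 1
    then show ?thesis using assms by (simp add: bump_def smooth_step_le_0 mult_le_0_iff)
  next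
    case 2
    have "1 * 1 \<le> real (Suc n) * (x - r)" "1 * 1 \<le> real (Suc n) * (x - l)"
      using 2 assms by (intro mult_mono; simp)+
    then show ?thesis by (simp add: bump_def smooth_step_ge_1)
  qed
qed

lemma bump_bounds: "\<bar>bump l r n x\<bar> \<le> 1"
  using smooth_step_bounds[of "real (Suc n) * (x - l)"] smooth_step_bounds[of "real (Suc n) * (x - r)"]
  unfolding bump_def by linarith

text \<open>At \<open>y = 0\<close> every member of the sequence is 0, which is why the limit is the
  indicator of the open half-line and plateaus later converge to half-open intervals.\<close>

lemma smooth_step_tendsto:
  "(\<lambda>n. smooth_step (real (Suc n) * y)) \<longlonglongrightarrow> indicator {0<..} y"
proof (cases "y > 0")
  case True
  obtain m :: nat where m: "1 / y \<le> real m" using real_arch_simple by blast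
  have "smooth_step (real (Suc n) * y) = 1" if "n \<ge> m" for n
  proof (rule smooth_step_ge_1)
    have "1 / y \<le> real (Suc n)" using m that by simp
    then show "1 \<le> real (Suc n) * y" using True by (simp add: divide_le_eq)
  qed
  then have "eventually (\<lambda>n. smooth_step (real (Suc n) * y) = 1) sequentially"
    by (rule eventually_sequentiallyI)
  then show ?thesis using True by (simp add: tendsto_eventually)
next
  case False
  then have "smooth_step (real (Suc n) * y) = 0" for n
    by (intro smooth_step_le_0) (simp add: mult_nonneg_nonpos)
  then show ?thesis using False by simp
qed

lemma bump_tendsto:
  assumes "l \<le> r"
  shows "(\<lambda>n. bump l r n x) \<longlonglongrightarrow> indicator {l<..r} x"
proof -
  have "(\<lambda>n. bump l r n x) \<longlonglongrightarrow> indicator {0<..} (x - l) - indicator {0<..} (x - r)"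
    unfolding bump_def by (intro tendsto_diff smooth_step_tendsto)
  also have "indicator {0<..} (x - l) - indicator {0<..} (x - r) = (indicator {l<..r} x :: real)"
    using assms by (auto simp: indicator_def)
  finally show ?thesis .
qed

lemma test_functionI:
  assumes "\<And>x. (\<phi> has_real_derivative \<phi>' x) (at x)" and "continuous_on UNIV \<phi>'"
    and "\<And>x. x \<notin> {l..r} \<Longrightarrow> \<phi> x = 0"
  shows "test_function \<phi>"
  unfolding test_function_def
proof
  show "\<phi> C1_differentiable_on UNIV"
    unfolding C1_differentiable_on_def
    using assms(1,2) by (auto simp: has_real_derivative_iff_has_vector_derivative)
  have "{x. \<phi> x \<noteq> 0} \<subseteq> {l..r}" using assms(3) by force
  then have "closure {x. \<phi> x \<noteq> 0} \<subseteq> {l..r}" by (rule closure_minimal) simp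
  then show "compact (closure {x. \<phi> x \<noteq> 0})"
    using compact_Int_closed[of "{l..r}" "closure {x. \<phi> x \<noteq> 0}"]
    by (simp add: Int_absorb1)
qed

lemma test_function_bump: "l \<le> r \<Longrightarrow> test_function (bump l r n)"
proof (rule test_functionI[OF bump_deriv])
  have "continuous_on UNIV (\<lambda>x. smooth_step' (real (Suc n) * (x - c)))" for c
    by (intro continuous_on_compose2[OF continuous_smooth_step'[of UNIV]] continuous_intros) auto
  then show "continuous_on UNIV (\<lambda>x. real (Suc n) * smooth_step' (real (Suc n) * (x - l))
       - real (Suc n) * smooth_step' (real (Suc n) * (x - r)))"
    by (intro continuous_intros)
qed (rule bump_outside)

lemma test_functionD:
  assumes "test_function \<phi>"
  obtains R K where "R > 0" "\<And>x. (\<phi> has_real_derivative deriv \<phi> x) (at x)"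
    "continuous_on UNIV (deriv \<phi>)" "continuous_on UNIV \<phi>"
    "\<And>x. x \<notin> {-R..R} \<Longrightarrow> \<phi> x = 0" "\<And>x. x \<notin> {-R..R} \<Longrightarrow> deriv \<phi> x = 0"
    "\<And>x. \<bar>\<phi> x\<bar> \<le> K" "\<And>x. \<bar>deriv \<phi> x\<bar> \<le> K" "\<phi> R = 0" "\<phi> (-R) = 0"
proof -
  obtain D where D: "\<And>x. (\<phi> has_real_derivative D x) (at x)" and contD: "continuous_on UNIV D"
    using assms unfolding test_function_def C1_differentiable_on_def
    by (auto simp: has_real_derivative_iff_has_vector_derivative)
  have eq: "deriv \<phi> = D" using D by (auto intro: DERIV_imp_deriv)
  have "bounded (closure {x. \<phi> x \<noteq> 0})"
    using assms by (auto simp: test_function_def intro: compact_imp_bounded)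
  then obtain R0 where R0: "\<And>x. x \<in> closure {x. \<phi> x \<noteq> 0} \<Longrightarrow> \<bar>x\<bar> \<le> R0"
    by (auto simp: bounded_iff)
  \<comment> \<open>The extra 1 makes \<open>\<phi>\<close> vanish at the endpoints \<open>R\<close>
    and \<open>-R\<close> themselves, so that boundary terms disappear in the fundamental theorem of
    calculus.\<close>
  define R where "R = \<bar>R0\<bar> + 1"
  have zero: "\<phi> x = 0" if "\<bar>x\<bar> > R0" for x
    using R0[of x] closure_subset[of "{x. \<phi> x \<noteq> 0}"] that by force
  have out: "\<phi> x = 0" if "x \<notin> {-R..R}" for x
    using zero[of x] that by (force simp: R_def)
  have out': "deriv \<phi> x = 0" if "x \<notin> {-R..R}" for x
  proof -
    have "((\<lambda>_. 0) has_real_derivative 0) (at x)" by simp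
    then have "(\<phi> has_real_derivative 0) (at x)"
      by (rule has_field_derivative_transform_within_open[where S = "- {-R..R}"])
        (use that out in \<open>auto intro: open_Compl\<close>)
    then show ?thesis by (rule DERIV_imp_deriv)
  qed
  have cont: "continuous_on UNIV \<phi>"
    using D by (auto intro!: continuous_at_imp_continuous_on dest: DERIV_isCont)
  have bdd: "\<exists>K. \<forall>x. \<bar>h x\<bar> \<le> K" if "continuous_on UNIV h" "\<And>x. x \<notin> {-R..R} \<Longrightarrow> h x = 0" for h :: "real \<Rightarrow> real"
  proof -
    have "compact (h ` {-R..R})"
      using that(1) by (intro compact_continuous_image continuous_on_subset[OF that(1)]) auto
    then obtain K where "\<forall>y\<in>h ` {-R..R}. \<bar>y\<bar> \<le> K"
      by (auto dest!: compact_imp_bounded simp: bounded_iff)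
    then have "\<bar>h x\<bar> \<le> \<bar>K\<bar>" for x
      using that(2)[of x] by (cases "x \<in> {-R..R}") force+
    then show ?thesis by blast
  qed
  obtain K1 where K1: "\<And>x. \<bar>\<phi> x\<bar> \<le> K1" using bdd[OF cont out] by blast
  obtain K2 where K2: "\<And>x. \<bar>deriv \<phi> x\<bar> \<le> K2"
    using bdd[of "deriv \<phi>"] contD out' by (auto simp: eq)
  show ?thesis
  proof (rule that[of R "max K1 K2"])
    show "\<bar>\<phi> x\<bar> \<le> max K1 K2" "\<bar>deriv \<phi> x\<bar> \<le> max K1 K2" for x
      using K1[of x] K2[of x] by auto
  qed (use D contD cont out out' zero in \<open>auto simp: R_def eq\<close>)
qed

section \<open>Interval integrals of weak derivatives\<close>

lemma has_weak_deriv_locally_integrable: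
  assumes "has_weak_deriv w g"
  shows "locally_integrable w" "locally_integrable g"
  using assms by (simp_all add: has_weak_deriv_def)

lemma continuous_imp_lebesgue_measurable:
  fixes h :: "real \<Rightarrow> real"
  assumes "continuous_on UNIV h"
  shows "h \<in> borel_measurable lebesgue"
  using assms by (intro measurable_completion) (simp add: borel_measurable_continuous_onI)

text \<open>The bridge from test functions to interval integrals: dominated convergence along the
  plateaus. The limit lives on \<open>{l<..r}\<close>, and the missing endpoint is a null
  set.\<close>

lemma bump_integral_tendsto:
  assumes "locally_integrable g" "l \<le> r"
  shows "(\<lambda>n. LINT x|lebesgue. g x * bump l r n x) \<longlonglongrightarrow> (LINT x:{l..r}|lebesgue. g x)"
proof -
  have [measurable]: "g \<in> borel_measurable lebesgue"
    using assms(1) by (rule locally_integrable_borel_measurable)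
  have [measurable]: "bump l r n \<in> borel_measurable lebesgue" for n
    by (rule test_functionD[OF test_function_bump[OF assms(2), of n]])
      (rule continuous_imp_lebesgue_measurable)
  have ind: "(indicator {l<..r} :: real \<Rightarrow> real) \<in> borel_measurable lebesgue"
    by (rule borel_measurable_indicator) simp
  have "(\<lambda>n. LINT x|lebesgue. g x * bump l r n x) \<longlonglongrightarrow> (LINT x|lebesgue. g x * indicator {l<..r} x)"
  proof (rule integral_dominated_convergence)
    show "integrable lebesgue (\<lambda>x. \<bar>indicator {l..r + 1} x *\<^sub>R g x\<bar>)"
      using locally_integrable_Icc[OF assms(1), of l "r + 1"]
      by (intro integrable_abs) (simp add: set_integrable_def)
    show "AE x in lebesgue. (\<lambda>n. g x * bump l r n x) \<longlonglongrightarrow> g x * indicator {l<..r} x"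
      by (intro AE_I2 tendsto_mult tendsto_const bump_tendsto assms)
    show "AE x in lebesgue. norm (g x * bump l r n x) \<le> \<bar>indicator {l..r + 1} x *\<^sub>R g x\<bar>" for n
    proof (intro AE_I2)
      fix x
      have "\<bar>g x\<bar> * \<bar>bump l r n x\<bar> \<le> \<bar>g x\<bar> * 1" by (intro mult_left_mono bump_bounds) simp
      then show "norm (g x * bump l r n x) \<le> \<bar>indicator {l..r + 1} x *\<^sub>R g x\<bar>"
        using bump_outside[OF assms(2), of x n]
        by (cases "x \<in> {l..r + 1}") (simp_all add: abs_mult)
    qed
  qed (use ind in measurable)
  moreover have "(LINT x|lebesgue. g x * indicator {l<..r} x) = (LINT x:{l..r}|lebesgue. g x)"
    unfolding set_lebesgue_integral_def
  proof (rule integral_cong_AE)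
    have "AE x in lebesgue. x \<noteq> l" by (rule AE_completion) (rule AE_lborel_singleton)
    then show "AE x in lebesgue. g x * indicator {l<..r} x = indicator {l..r} x *\<^sub>R g x"
      by eventually_elim (auto simp: indicator_def)
  qed (use ind in measurable)
  ultimately show ?thesis by simp
qed

text \<open>Two weak derivatives agree against every plateau, hence have equal integrals over every
  interval.\<close>

lemma has_weak_deriv_unique:
  assumes "has_weak_deriv w g" "has_weak_deriv w h"
  shows "AE x in lebesgue. g x = h x"
proof -
  note int = has_weak_deriv_locally_integrable[OF assms(1)] has_weak_deriv_locally_integrable[OF assms(2)]
  have "AE x in lebesgue. g x - h x = 0"
  proof (rule AE_zero_of_interval_integrals_zero)
    show "locally_integrable (\<lambda>x. g x - h x)"
      using int by (auto simp: locally_integrable_def)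
    fix l r :: real assume lr: "l \<le> r"
    have "(LINT x|lebesgue. g x * bump l r n x) = (LINT x|lebesgue. h x * bump l r n x)" for n
      using assms test_function_bump[OF lr] by (simp add: has_weak_deriv_def)
    then have "(LINT x:{l..r}|lebesgue. g x) = (LINT x:{l..r}|lebesgue. h x)"
      using bump_integral_tendsto[OF int(2) lr] bump_integral_tendsto[OF int(4) lr]
      by (simp add: LIMSEQ_unique)
    then show "(LINT x:{l..r}|lebesgue. g x - h x) = 0"
      using int by (subst set_integral_diff) (auto intro: locally_integrable_Icc)
  qed
  then show ?thesis by eventually_elim simp
qed

lemma has_weak_deriv_weak_deriv: "has_weak_deriv w g \<Longrightarrow> has_weak_deriv w (weak_deriv w)"
  unfolding weak_deriv_def by (rule someI[of "has_weak_deriv w"])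

lemma weak_deriv_AE_eq: "has_weak_deriv w g \<Longrightarrow> AE x in lebesgue. weak_deriv w x = g x"
  by (rule has_weak_deriv_unique[OF has_weak_deriv_weak_deriv])

lemma periodic_H1_has_weak_deriv: "periodic_H1 N w \<Longrightarrow> has_weak_deriv w (weak_deriv w)"
  by (auto simp: periodic_H1_def intro: has_weak_deriv_weak_deriv)

text \<open>Testing with a plateau function whose two ramps are translates of each other by the period
  makes the contributions of the ramps cancel.\<close>

lemma has_weak_deriv_periodic_integral_zero:
  assumes w: "has_weak_deriv w g" and per: "\<And>x. w (x + p) = w x" and "0 \<le> p"
  shows "(LINT x:{l..l + p}|lebesgue. g x) = 0"
proof -
  note int = has_weak_deriv_locally_integrable[OF w]
  have lr: "l \<le> l + p" using assms by simp
  have "(LINT x|lebesgue. g x * bump l (l + p) n x) = 0" for n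
  proof -
    \<comment> \<open>\<open>T c\<close> is the derivative of the ramp starting at \<open>c\<close>;
      shifting the argument by \<open>p\<close> turns \<open>T (l + p)\<close> into
      \<open>T l\<close>, and \<open>w\<close> does not change under this shift.\<close>
    define T where "T c x = real (Suc n) * smooth_step' (real (Suc n) * (x - c))" for c x
    have T: "integrable lebesgue (\<lambda>x. w x * T c x)" for c
    proof (rule integrable_mult_compact_support[OF int(1)])
      have "continuous_on UNIV (T c)"
        unfolding T_def
        by (intro continuous_on_mult continuous_on_const
            continuous_on_compose2[OF continuous_smooth_step'[of UNIV]] continuous_intros) auto
      then show "T c \<in> borel_measurable lebesgue" by (rule continuous_imp_lebesgue_measurable)
      show "\<bar>T c x\<bar> \<le> real (Suc n) * 2" for x
        unfolding T_def abs_mult by (intro mult_mono smooth_step'_bounds) auto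
      show "T c x = 0" if "x \<notin> {c..c + 1}" for x
      proof -
        have "real (Suc n) * (x - c) \<notin> {0..1}"
        proof
          assume a: "real (Suc n) * (x - c) \<in> {0..1}"
          then have "0 \<le> x - c" by (simp add: zero_le_mult_iff)
          moreover have "1 * (x - c) \<le> real (Suc n) * (x - c)"
            using calculation by (intro mult_right_mono) auto
          ultimately show False using a that by auto
        qed
        then show ?thesis by (simp add: T_def smooth_step'_outside)
      qed
    qed
    have "deriv (bump l (l + p) n) x = T l x - T (l + p) x" for x
      unfolding T_def by (rule DERIV_imp_deriv[OF bump_deriv])
    then have "(LINT x|lebesgue. w x * deriv (bump l (l + p) n) x)
        = (LINT x|lebesgue. w x * T l x) - (LINT x|lebesgue. w x * T (l + p) x)"
      using T by (simp add: right_diff_distrib)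
    also have "(LINT x|lebesgue. w x * T (l + p) x) = (LINT x|lebesgue. w (x + p) * T (l + p) (x + p))"
      by (rule lebesgue_integral_shift[symmetric, where f = "\<lambda>x. w x * T (l + p) x"])
    also have "\<dots> = (LINT x|lebesgue. w x * T l x)"
      by (simp add: per T_def)
    finally show ?thesis
      using w test_function_bump[OF lr] by (simp add: has_weak_deriv_def)
  qed
  then show ?thesis
    using bump_integral_tendsto[OF int(2) lr] by (simp add: LIMSEQ_const_iff)
qed

lemma locally_integrable_shift:
  assumes "locally_integrable g"
  shows "locally_integrable (\<lambda>x. g (x + s))"
  unfolding locally_integrable_def
proof
  fix r :: real
  have "indicator {-r..r} x = (indicator {-r + s..r + s} (s + 1 * x) :: real)" for x
    by (auto simp: indicator_def)
  then show "set_integrable lebesgue {-r..r} (\<lambda>x. g (x + s))"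
    using locally_integrable_Icc[OF assms, of "-r + s" "r + s"]
      lebesgue_integrable_real_affine_iff[of 1 "\<lambda>x. indicator {-r + s..r + s} x *\<^sub>R g x" s]
    by (simp add: set_integrable_def add.commute)
qed

text \<open>Combined with uniqueness, this makes the weak derivative of a periodic function periodic
  almost everywhere. The shift is moved onto the test function in the opposite direction.\<close>

lemma has_weak_deriv_shift:
  assumes "has_weak_deriv w g"
  shows "has_weak_deriv (\<lambda>x. w (x + s)) (\<lambda>x. g (x + s))"
  unfolding has_weak_deriv_def
proof (intro conjI allI impI)
  show "locally_integrable (\<lambda>x. w (x + s))" "locally_integrable (\<lambda>x. g (x + s))"
    by (intro locally_integrable_shift has_weak_deriv_locally_integrable[OF assms])+
  fix \<phi> assume "test_function \<phi>"
  then obtain R K where \<phi>: "\<And>x. (\<phi> has_real_derivative deriv \<phi> x) (at x)"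
    "continuous_on UNIV (deriv \<phi>)" "\<And>x. x \<notin> {-R..R} \<Longrightarrow> \<phi> x = 0"
    by (rule test_functionD) blast
  define \<psi> where "\<psi> = (\<lambda>x. \<phi> (x - s))"
  have d: "(\<psi> has_real_derivative deriv \<phi> (x - s)) (at x)" for x
  proof -
    have "((\<lambda>x. x - s) has_real_derivative 1) (at x)" by (auto intro!: derivative_eq_intros)
    then show ?thesis unfolding \<psi>_def using DERIV_chain2[OF \<phi>(1)] by fastforce
  qed
  have "test_function \<psi>"
  proof (rule test_functionI[OF d])
    show "continuous_on UNIV (\<lambda>x. deriv \<phi> (x - s))"
      by (intro continuous_on_compose2[OF \<phi>(2)] continuous_intros) auto
    show "\<psi> x = 0" if "x \<notin> {-R + s..R + s}" for x
      using that \<phi>(3)[of "x - s"] by (auto simp: \<psi>_def)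
  qed
  then have "(LINT x|lebesgue. w x * deriv \<psi> x) = - (LINT x|lebesgue. g x * \<psi> x)"
    using assms by (simp add: has_weak_deriv_def)
  moreover have "deriv \<psi> x = deriv \<phi> (x - s)" for x using d by (rule DERIV_imp_deriv)
  ultimately show "(LINT x|lebesgue. w (x + s) * deriv \<phi> x) = - (LINT x|lebesgue. g (x + s) * \<phi> x)"
    using lebesgue_integral_shift[of "\<lambda>x. w x * deriv \<phi> (x - s)" s]
      lebesgue_integral_shift[of "\<lambda>x. g x * \<psi> x" s]
    by (simp add: \<psi>_def)
qed

section \<open>Primitives of bounded functions\<close>

text \<open>Normalised to vanish at \<open>0\<close>; the difference of indicators replaces an oriented integral.\<close>

definition antideriv :: "(real \<Rightarrow> real) \<Rightarrow> real \<Rightarrow> real" where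
  "antideriv g x = (LINT t|lborel. (indicator {..x} t - indicator {..0} t) * g t)"

lemma integrable_bounded_support:
  fixes f :: "real \<Rightarrow> real"
  assumes "f \<in> borel_measurable borel" "\<And>x. \<bar>f x\<bar> \<le> K * indicator {l..r} x"
  shows "integrable lborel f"
proof (rule Bochner_Integration.integrable_bound)
  show "integrable lborel (\<lambda>x. K * indicator {l..r} x :: real)"
    by (intro integrable_mult_right integrable_real_indicator) (simp_all add: emeasure_lborel_Icc_eq)
  show "AE x in lborel. norm (f x) \<le> norm (K * indicator {l..r} x :: real)"
    using assms(2) by (intro AE_I2) (simp add: order_trans[OF _ abs_ge_self])
qed (use assms(1) in simp)

context
  fixes g :: "real \<Rightarrow> real" and K :: real
  assumes g_borel [measurable]: "g \<in> borel_measurable borel"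
    and g_bound: "\<And>x. \<bar>g x\<bar> \<le> K"
begin

lemma integrable_step_difference:
  "integrable lborel (\<lambda>t. (indicator {..b} t - indicator {..a} t) * g t)"
proof (rule integrable_bounded_support)
  show "\<bar>(indicator {..b} t - indicator {..a} t) * g t\<bar> \<le> K * indicator {min a b..max a b} t" for t
    using g_bound[of t] by (auto simp: indicator_def abs_mult)
qed measurable

lemma antideriv_diff:
  "antideriv g b - antideriv g a = (LINT t|lborel. (indicator {..b} t - indicator {..a} t) * g t)"
proof -
  have "antideriv g b - antideriv g a = (LINT t|lborel.
      (indicator {..b} t - indicator {..0} t) * g t - (indicator {..a} t - indicator {..0} t) * g t)"
    unfolding antideriv_def
    by (rule Bochner_Integration.integral_diff[symmetric]) (rule integrable_step_difference)+
  also have "\<dots> = (LINT t|lborel. (indicator {..b} t - indicator {..a} t) * g t)"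
    by (simp add: algebra_simps)
  finally show ?thesis .
qed

lemma antideriv_lipschitz: "\<bar>antideriv g b - antideriv g a\<bar> \<le> K * \<bar>b - a\<bar>"
proof -
  have "\<bar>antideriv g b - antideriv g a\<bar> \<le> (LINT t|lborel. K * indicator {min a b..max a b} t)"
    unfolding antideriv_diff
  proof (rule integral_abs_bound[THEN order_trans], rule integral_mono)
    show "integrable lborel (\<lambda>t. \<bar>(indicator {..b} t - indicator {..a} t) * g t\<bar>)"
      by (intro integrable_abs integrable_step_difference)
    show "integrable lborel (\<lambda>t. K * indicator {min a b..max a b} t :: real)"
      by (intro integrable_mult_right integrable_real_indicator) (simp_all add: emeasure_lborel_Icc_eq)
    show "\<bar>(indicator {..b} t - indicator {..a} t) * g t\<bar> \<le> K * indicator {min a b..max a b} t" for t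
      using g_bound[of t] by (auto simp: indicator_def abs_mult)
  qed
  then show ?thesis by (simp add: max_def min_def split: if_splits)
qed

lemma continuous_antideriv: "continuous_on UNIV (antideriv g)"
proof (rule lipschitz_on_continuous_on)
  have "0 \<le> K" using g_bound[of 0] by linarith
  then show "K-lipschitz_on UNIV (antideriv g)"
    using antideriv_lipschitz by (auto simp: lipschitz_on_def dist_real_def)
qed

lemma antideriv_bounded: "\<exists>C. \<forall>x\<in>{-r..r}. \<bar>antideriv g x\<bar> \<le> C"
proof (intro exI ballI)
  fix x assume "x \<in> {-r..r}"
  then have "K * \<bar>x\<bar> \<le> K * r" using g_bound[of 0] by (intro mult_left_mono) auto
  then show "\<bar>antideriv g x\<bar> \<le> K * r"
    using antideriv_lipschitz[of x 0] by (simp add: antideriv_def)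
qed

text \<open>Periodicity of \<open>g\<close> makes increments of the primitive invariant under
  translation by \<open>p\<close>. The increment over one period is therefore the same from every
  starting point, and from \<open>l\<close> it is the vanishing integral.\<close>

lemma antideriv_periodic:
  assumes per: "\<And>x. g (x + p) = g x" and zero: "(LINT x:{l..l + p}|lborel. g x) = 0" and "0 \<le> p"
  shows "antideriv g (x + p) = antideriv g x"
proof -
  define P where "P x = antideriv g (x + p) - antideriv g x" for x
  have shift: "antideriv g (b + p) - antideriv g (a + p) = antideriv g b - antideriv g a" for a b
  proof -
    have "antideriv g (b + p) - antideriv g (a + p)
        = (LINT t|lborel. (indicator {..b + p} (p + 1 * t) - indicator {..a + p} (p + 1 * t)) * g (p + 1 * t))"
      unfolding antideriv_diff by (subst lborel_integral_real_affine[where c = 1 and t = p]) simp_all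
    also have "\<dots> = (LINT t|lborel. (indicator {..b} t - indicator {..a} t) * g t)"
      using per by (intro Bochner_Integration.integral_cong) (auto simp: indicator_def add.commute)
    finally show ?thesis by (simp add: antideriv_diff)
  qed
  have "P l = (LINT x:{l..l + p}|lborel. g x)"
    unfolding P_def antideriv_diff set_lebesgue_integral_def
  proof (rule integral_cong_AE)
    have "AE t in lborel. t \<noteq> l" by (rule AE_lborel_singleton)
    then show "AE t in lborel. (indicator {..l + p} t - indicator {..l} t) * g t
        = indicator {l..l + p} t *\<^sub>R g t"
      by eventually_elim (use \<open>0 \<le> p\<close> in \<open>auto simp: indicator_def\<close>)
  qed measurable
  moreover have "P x = P l" using shift[of x l] by (simp add: P_def)
  ultimately show ?thesis using zero by (simp add: P_def)
qed

text \<open>Integration by parts through Fubini: the primitive times \<open>deriv \<phi>\<close> is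
  a double integral over the region \<open>t \<le> x\<close>, and integrating over \<open>x\<close>
  before \<open>t\<close> gives \<open>- \<phi> t\<close>. No pointwise differentiability of the
  primitive enters.\<close>

lemma has_weak_deriv_antideriv: "has_weak_deriv (antideriv g) g"
  unfolding has_weak_deriv_def
proof (intro conjI allI impI)
  let ?W = "antideriv g"
  have W_meas [measurable]: "?W \<in> borel_measurable borel"
    using continuous_antideriv by (rule borel_measurable_continuous_onI)
  show "locally_integrable ?W"
    using continuous_antideriv antideriv_bounded
    by (intro locally_integrable_bounded continuous_imp_lebesgue_measurable) auto
  show "locally_integrable g"
    using g_bound by (intro locally_integrable_bounded measurable_completion) auto
  fix \<phi> assume "test_function \<phi>"
  then obtain R C where R: "R > 0" and d: "\<And>x. (\<phi> has_real_derivative deriv \<phi> x) (at x)"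
    and cont: "continuous_on UNIV (deriv \<phi>)" "continuous_on UNIV \<phi>"
    and out: "\<And>x. x \<notin> {-R..R} \<Longrightarrow> \<phi> x = 0" "\<And>x. x \<notin> {-R..R} \<Longrightarrow> deriv \<phi> x = 0"
    and bound: "\<And>x. \<bar>\<phi> x\<bar> \<le> C" "\<And>x. \<bar>deriv \<phi> x\<bar> \<le> C" and ends: "\<phi> R = 0" "\<phi> (-R) = 0"
    by (rule test_functionD) blast
  have [measurable]: "deriv \<phi> \<in> borel_measurable borel" "\<phi> \<in> borel_measurable borel"
    using cont by (auto intro: borel_measurable_continuous_onI)
  have K0: "0 \<le> K" and C0: "0 \<le> C"
    using g_bound[of 0] bound(1)[of 0] by linarith+
  have FTC: "(LINT x|lborel. deriv \<phi> x * indicator {t..R} x) = - \<phi> t" if "t \<le> R" for t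
    using integral_FTC_Icc_real[of t R \<phi> "deriv \<phi>"] that d cont ends
    by (simp add: continuous_on_eq_continuous_at)
  have int_d: "integrable lborel (deriv \<phi>)"
  proof (rule integrable_bounded_support)
    show "\<bar>deriv \<phi> x\<bar> \<le> C * indicator {-R..R} x" for x
      using bound(2)[of x] out(2)[of x] by (cases "x \<in> {-R..R}") auto
  qed measurable
  \<comment> \<open>The integrand is confined to the square of side \<open>2 * R\<close>: in
    \<open>t\<close> by the indicator, in \<open>x\<close> by the support of
    \<open>deriv \<phi>\<close>. Boundedness then gives joint integrability.\<close>
  define F where "F x t = deriv \<phi> x * (indicator {-R..R} t * (if t \<le> x then 1 else 0) * g t)" for x t
  have int_F: "integrable (lborel \<Otimes>\<^sub>M lborel) (case_prod F)"
  proof (rule Bochner_Integration.integrable_bound)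
    have "integrable (lborel \<Otimes>\<^sub>M lborel) (indicator ({-R..R} \<times> {-R..R}) :: real \<times> real \<Rightarrow> real)"
      by (intro integrable_real_indicator)
        (auto simp: lborel.emeasure_pair_measure_Times emeasure_lborel_Icc_eq ennreal_mult_less_top)
    then show "integrable (lborel \<Otimes>\<^sub>M lborel) (\<lambda>z. C * K * indicator ({-R..R} \<times> {-R..R}) z :: real)"
      by (rule integrable_mult_right)
    show "case_prod F \<in> borel_measurable (lborel \<Otimes>\<^sub>M lborel)"
      unfolding F_def by measurable
    show "AE z in lborel \<Otimes>\<^sub>M lborel. norm (case_prod F z)
        \<le> norm (C * K * indicator ({-R..R} \<times> {-R..R}) z :: real)"
    proof (intro AE_I2)
      fix z :: "real \<times> real"
      obtain x t where z: "z = (x, t)" by (cases z)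
      have "\<bar>deriv \<phi> x\<bar> * \<bar>g t\<bar> \<le> C * K" using bound(2) g_bound C0 by (intro mult_mono) auto
      moreover have "0 \<le> C * K" using C0 K0 by simp
      ultimately show "norm (case_prod F z) \<le> norm (C * K * indicator ({-R..R} \<times> {-R..R}) z :: real)"
        using out(2)[of x] C0 K0 by (auto simp: z F_def indicator_def abs_mult)
    qed
  qed
  have inner: "(?W x - ?W (-R)) * deriv \<phi> x = (LINT t|lborel. F x t)" for x
  proof (cases "x \<in> {-R..R}")
    case True
    have "(LINT t|lborel. (indicator {..x} t - indicator {..-R} t) * g t)
        = (LINT t|lborel. indicator {-R..R} t * (if t \<le> x then 1 else 0) * g t)"
    proof (rule integral_cong_AE)
      have "AE t in lborel. t \<noteq> -R" by (rule AE_lborel_singleton)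
      then show "AE t in lborel. (indicator {..x} t - indicator {..-R} t) * g t
          = indicator {-R..R} t * (if t \<le> x then 1 else 0) * g t"
        by eventually_elim (use True in \<open>auto simp: indicator_def\<close>)
    qed measurable
    then show ?thesis by (simp add: F_def antideriv_diff)
  qed (simp add: F_def out)
  have int_W: "integrable lborel (\<lambda>x. ?W x * deriv \<phi> x)"
  proof -
    obtain D where D: "\<forall>x\<in>{-R..R}. \<bar>?W x\<bar> \<le> D" using antideriv_bounded by blast
    show ?thesis
    proof (rule integrable_bounded_support)
      show "\<bar>?W x * deriv \<phi> x\<bar> \<le> D * C * indicator {-R..R} x" for x
      proof (cases "x \<in> {-R..R}")
        case True
        then have "\<bar>?W x\<bar> * \<bar>deriv \<phi> x\<bar> \<le> D * C"
          using D bound(2)[of x] by (intro mult_mono) force+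
        then show ?thesis using True by (simp add: abs_mult)
      qed (simp add: out)
    qed measurable
  qed
  \<comment> \<open>Since \<open>deriv \<phi>\<close> has integral zero, the base point of the
    primitive can be moved from 0 to \<open>-R\<close>, where the increment is a plain integral over
    \<open>t\<close> between \<open>-R\<close> and \<open>x\<close>.\<close>
  have "(LINT x|lborel. deriv \<phi> x) = 0"
  proof -
    have "(LINT x|lborel. deriv \<phi> x) = (LINT x|lborel. deriv \<phi> x * indicator {-R..R} x)"
      using out(2) by (intro Bochner_Integration.integral_cong) (auto simp: indicator_def)
    then show ?thesis using FTC[of "-R"] R ends by simp
  qed
  then have "(LINT x|lborel. ?W x * deriv \<phi> x) = (LINT x|lborel. (?W x - ?W (-R)) * deriv \<phi> x)"
    using int_W int_d by (simp add: left_diff_distrib)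
  also have "\<dots> = (LINT x|lborel. LINT t|lborel. F x t)"
    by (simp add: inner)
  also have "\<dots> = (LINT t|lborel. LINT x|lborel. F x t)"
    by (rule lborel_pair.Fubini_integral[OF int_F, symmetric])
  also have "\<dots> = (LINT t|lborel. - (g t * \<phi> t))"
  proof (intro Bochner_Integration.integral_cong refl)
    fix t
    show "(LINT x|lborel. F x t) = - (g t * \<phi> t)"
    proof (cases "t \<in> {-R..R}")
      case True
      have "(LINT x|lborel. F x t) = (LINT x|lborel. g t * (deriv \<phi> x * indicator {t..R} x))"
        using out(2) True by (intro Bochner_Integration.integral_cong) (auto simp: F_def indicator_def)
      then show ?thesis using FTC[of t] True by simp
    qed (simp add: F_def out)
  qed
  finally have *: "(LINT x|lborel. ?W x * deriv \<phi> x) = - (LINT x|lborel. g x * \<phi> x)"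
    by simp
  show "(LINT x|lebesgue. ?W x * deriv \<phi> x) = - (LINT x|lebesgue. g x * \<phi> x)"
    using * by (simp add: integral_completion)
qed

end

section \<open>The flux of a corrector\<close>

lemma cell_sets [simp, measurable]: "cell N \<in> sets lebesgue" "cell N \<in> sets borel"
  by (simp_all add: cell_def)

lemma set_integrable_cell: "locally_integrable f \<Longrightarrow> set_integrable lebesgue (cell N) f"
  unfolding cell_def by (rule locally_integrable_Icc)

lemma set_integrable_const_cell [simp]: "set_integrable lebesgue (cell N) (\<lambda>_. c :: real)"
  unfolding cell_def by (rule set_integrable_const_Icc)

lemma set_integral_const_cell [simp]: "(LINT x:cell N|lebesgue. c) = c * real N"
  by (simp add: set_lebesgue_integral_def cell_def)

lemma set_integrable_bounded_mult:
  fixes f h :: "real \<Rightarrow> real"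
  assumes "set_integrable lebesgue S f" "h \<in> borel_measurable lebesgue" "S \<in> sets lebesgue"
    and "f \<in> borel_measurable lebesgue"
    and "AE x in lebesgue. x \<in> S \<longrightarrow> \<bar>h x\<bar> \<le> K"
  shows "set_integrable lebesgue S (\<lambda>x. h x * f x)"
  unfolding set_integrable_def
proof (rule Bochner_Integration.integrable_bound)
  show "integrable lebesgue (\<lambda>x. K * (indicator S x *\<^sub>R f x))"
    using assms(1) by (simp add: set_integrable_def)
  have [measurable]: "indicat_real S \<in> borel_measurable lebesgue"
    using assms(3) by (rule borel_measurable_indicator)
  show "(\<lambda>x. indicator S x *\<^sub>R (h x * f x)) \<in> borel_measurable lebesgue"
    using assms(2,4) by measurable
  show "AE x in lebesgue. norm (indicator S x *\<^sub>R (h x * f x)) \<le> norm (K * (indicator S x *\<^sub>R f x))"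
    using assms(5)
  proof eventually_elim
    case (elim x)
    show ?case
    proof (cases "x \<in> S")
      case True
      then have "\<bar>h x\<bar> * \<bar>f x\<bar> \<le> \<bar>K\<bar> * \<bar>f x\<bar>" using elim by (intro mult_right_mono) auto
      then show ?thesis using True by (simp add: abs_mult)
    qed simp
  qed
qed

text \<open>The set is a parameter because a corrector problem sees the coefficient only on its
  cell, whereas arguments by periodicity use the bounds on the whole line.\<close>

definition elliptic_on :: "real set \<Rightarrow> real \<Rightarrow> real \<Rightarrow> (real \<Rightarrow> real) \<Rightarrow> bool" where
  "elliptic_on S \<alpha> \<beta> A \<longleftrightarrow> A \<in> borel_measurable lebesgue \<and> 0 < \<alpha> \<and>
     (AE x in lebesgue. x \<in> S \<longrightarrow> \<alpha> \<le> A x \<and> A x \<le> \<beta>)"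

lemma elliptic_on_inverse_integrable:
  assumes "elliptic_on (cell N) \<alpha> \<beta> A"
  shows "set_integrable lebesgue (cell N) (\<lambda>x. 1 / A x)"
proof -
  have [measurable]: "A \<in> borel_measurable lebesgue" and "0 < \<alpha>"
    and ae: "AE x in lebesgue. x \<in> cell N \<longrightarrow> \<alpha> \<le> A x \<and> A x \<le> \<beta>"
    using assms by (auto simp: elliptic_on_def)
  have "set_integrable lebesgue (cell N) (\<lambda>x. (1 / A x) * 1)"
  proof (rule set_integrable_bounded_mult)
    show "AE x in lebesgue. x \<in> cell N \<longrightarrow> \<bar>1 / A x\<bar> \<le> 1 / \<alpha>"
      using ae by eventually_elim (use \<open>0 < \<alpha>\<close> in \<open>auto intro: divide_left_mono\<close>)
  qed simp_all
  then show ?thesis by simp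
qed

lemma elliptic_on_inverse_integral_pos:
  assumes "elliptic_on (cell N) \<alpha> \<beta> A" "0 < N"
  shows "0 < (LINT x:cell N|lebesgue. 1 / A x)"
proof -
  have "0 < \<alpha>" and ae: "AE x in lebesgue. x \<in> cell N \<longrightarrow> \<alpha> \<le> A x \<and> A x \<le> \<beta>"
    using assms by (auto simp: elliptic_on_def)
  \<comment> \<open>\<open>max \<alpha> \<beta>\<close> is visibly positive, so its reciprocal is a
    positive lower bound for \<open>1 / A\<close>.\<close>
  have "(LINT x:cell N|lebesgue. 1 / max \<alpha> \<beta>) \<le> (LINT x:cell N|lebesgue. 1 / A x)"
  proof (rule set_integral_mono_AE)
    show "AE x\<in>cell N in lebesgue. 1 / max \<alpha> \<beta> \<le> 1 / A x"
      using ae by eventually_elim (use \<open>0 < \<alpha>\<close> in \<open>auto intro!: divide_left_mono\<close>)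
  qed (simp_all add: elliptic_on_inverse_integrable[OF assms(1)])
  moreover have "0 < (LINT x:cell N|lebesgue. 1 / max \<alpha> \<beta>)"
    using assms(2) \<open>0 < \<alpha>\<close> by (simp add: less_max_iff_disj)
  ultimately show ?thesis by linarith
qed

text \<open>The harmonic mean \<open>H\<close> makes \<open>H / A - 1\<close> mean-free, so its periodic extension has a
  periodic primitive, whose flux is the constant \<open>H\<close>.\<close>

lemma harmonic_potential:
  assumes ell: "elliptic_on (cell N) \<alpha> \<beta> A" and N: "0 < N"
    and H: "H = real N / (LINT x:cell N|lebesgue. 1 / A x)"
  obtains w where "periodic_H1 N w" "AE x in lebesgue. x \<in> cell N \<longrightarrow> weak_deriv w x = H / A x - 1"
proof -
  have A: "A \<in> borel_measurable lebesgue" and \<alpha>: "0 < \<alpha>"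
    and ae: "AE x in lebesgue. x \<in> cell N \<longrightarrow> \<alpha> \<le> A x \<and> A x \<le> \<beta>"
    using ell by (auto simp: elliptic_on_def)
  note [measurable] = A
  obtain A' where A'[measurable]: "A' \<in> borel_measurable borel" and eq: "AE x in lborel. A x = A' x"
    using completion_ex_borel_measurable_real[OF A] by auto
  \<comment> \<open>Reduction modulo \<open>N\<close> to the half-open period. It sends the right
    end of the cell to the left end, so that point is discarded below as a null set.\<close>
  define r where "r x = x - real N * of_int \<lfloor>x / real N + 1/2\<rfloor>" for x
  \<comment> \<open>The ellipticity bounds hold only almost everywhere. Clamping the Borel version
    \<open>A'\<close> makes \<open>g\<close> bounded at every point, as the primitive requires, and
    changes nothing almost everywhere on the cell.\<close>
  define g where "g x = H / max \<alpha> (min \<beta> (A' (r x))) - 1" for x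
  have [measurable]: "r \<in> borel_measurable borel" unfolding r_def by measurable
  have g_meas [measurable]: "g \<in> borel_measurable borel" unfolding g_def by measurable
  have g_bound: "\<bar>g x\<bar> \<le> \<bar>H\<bar> / \<alpha> + 1" for x
  proof -
    have "\<bar>H / max \<alpha> (min \<beta> (A' (r x)))\<bar> \<le> \<bar>H\<bar> / \<alpha>"
      using \<alpha> by (auto simp: abs_divide intro!: divide_left_mono mult_pos_pos)
    then show ?thesis unfolding g_def by linarith
  qed
  have g_meas' [measurable]: "g \<in> borel_measurable lebesgue"
    using g_meas by (intro measurable_completion) simp
  have per: "g (x + real N) = g x" for x
  proof -
    have "(x + real N) / real N + 1/2 = x / real N + 1/2 + of_int 1"
      using N by (simp add: add_divide_distrib)
    then have "\<lfloor>(x + real N) / real N + 1/2\<rfloor> = \<lfloor>x / real N + 1/2\<rfloor> + 1"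
      by (simp only: floor_add_int)
    then have "r (x + real N) = r x"
      by (simp add: r_def algebra_simps)
    then show ?thesis by (simp add: g_def)
  qed
  have "AE x in lebesgue. x \<noteq> real N / 2" by (rule AE_completion) (rule AE_lborel_singleton)
  then have g_eq: "AE x in lebesgue. x \<in> cell N \<longrightarrow> g x = H / A x - 1"
    using ae AE_completion[OF eq]
  proof eventually_elim
    case (elim x)
    show ?case
    proof
      assume x: "x \<in> cell N"
      have "\<lfloor>x / real N + 1/2\<rfloor> = 0"
        using x elim(1) N by (simp add: floor_eq_iff cell_def field_simps)
      then have "r x = x" by (simp add: r_def)
      then show "g x = H / A x - 1" using elim x by (simp add: g_def min_def max_def)
    qed
  qed
  have pos: "0 < (LINT x:cell N|lebesgue. 1 / A x)"
    by (rule elliptic_on_inverse_integral_pos[OF ell N])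
  have "(LINT x:cell N|lebesgue. g x) = (LINT x:cell N|lebesgue. H * (1 / A x) - 1)"
    by (rule set_lebesgue_integral_cong_AE) (use g_eq in auto)
  also have "\<dots> = H * (LINT x:cell N|lebesgue. 1 / A x) - real N"
    using elliptic_on_inverse_integrable[OF ell]
    by (subst set_integral_diff) (simp_all del: times_divide_eq_right)
  finally have zero: "(LINT x:cell N|lebesgue. g x) = 0"
    using pos by (simp add: H)
  have "(LINT x:{- (real N / 2)..- (real N / 2) + real N}|lborel. g x) = (LINT x:cell N|lebesgue. g x)"
    by (simp add: set_lebesgue_integral_def cell_def integral_completion)
  then have perW: "antideriv g (x + real N) = antideriv g x" for x
    using zero antideriv_periodic[OF g_meas g_bound per, of "- (real N / 2)"] by simp
  have wd: "has_weak_deriv (antideriv g) g"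
    by (rule has_weak_deriv_antideriv[OF g_meas g_bound])
  have cont: "continuous_on UNIV (antideriv g)"
    by (rule continuous_antideriv[OF g_meas g_bound])
  have "locally_L2 (antideriv g)"
    unfolding locally_L2_def
  proof
    have "continuous_on UNIV (\<lambda>x. (antideriv g x)\<^sup>2)" using cont by (intro continuous_intros)
    then show "locally_integrable (\<lambda>x. (antideriv g x)\<^sup>2)"
    proof (intro locally_integrable_bounded continuous_imp_lebesgue_measurable)
      fix \<rho>
      obtain C where "\<forall>x\<in>{-\<rho>..\<rho>}. \<bar>antideriv g x\<bar> \<le> C"
        using antideriv_bounded[OF g_meas g_bound] by blast
      then have "\<forall>x\<in>{-\<rho>..\<rho>}. \<bar>(antideriv g x)\<^sup>2\<bar> \<le> C\<^sup>2"
        by (auto simp: abs_le_square_iff[symmetric] intro: order_trans[OF _ abs_ge_self])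
      then show "\<exists>C. \<forall>x\<in>{-\<rho>..\<rho>}. \<bar>(antideriv g x)\<^sup>2\<bar> \<le> C" by blast
    qed
  qed (rule continuous_imp_lebesgue_measurable[OF cont])
  moreover have "locally_L2 g"
    unfolding locally_L2_def
  proof
    show "locally_integrable (\<lambda>x. (g x)\<^sup>2)"
    proof (rule locally_integrable_bounded)
      have "\<bar>(g x)\<^sup>2\<bar> \<le> (\<bar>H\<bar> / \<alpha> + 1)\<^sup>2" for x
        using g_bound[of x] by (simp add: abs_le_square_iff[symmetric] order_trans[OF _ abs_ge_self])
      then show "\<exists>C. \<forall>x\<in>{-\<rho>..\<rho>}. \<bar>(g x)\<^sup>2\<bar> \<le> C" for \<rho> by blast
    qed measurable
  qed (rule g_meas')
  ultimately have "periodic_H1 N (antideriv g)"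
    using wd perW by (auto simp: periodic_H1_def)
  moreover have "AE x in lebesgue. x \<in> cell N \<longrightarrow> weak_deriv (antideriv g) x = H / A x - 1"
    using weak_deriv_AE_eq[OF wd] g_eq by eventually_elim simp
  ultimately show ?thesis by (rule that)
qed

lemma periodic_H1_weak_deriv_integral_zero:
  assumes "periodic_H1 N w"
  shows "(LINT x:cell N|lebesgue. weak_deriv w x) = 0"
  using has_weak_deriv_periodic_integral_zero[OF periodic_H1_has_weak_deriv[OF assms], of "real N" "- (real N / 2)"]
    assms by (simp add: periodic_H1_def cell_def)

lemma weak_deriv_measurable: "periodic_H1 N w \<Longrightarrow> weak_deriv w \<in> borel_measurable lebesgue"
  by (blast intro: locally_integrable_borel_measurable has_weak_deriv_locally_integrable(2)
      periodic_H1_has_weak_deriv)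

lemma weak_deriv_integrable_cell:
  "periodic_H1 N w \<Longrightarrow> set_integrable lebesgue (cell M) (weak_deriv w)"
  by (blast intro: set_integrable_cell has_weak_deriv_locally_integrable(2)
      periodic_H1_has_weak_deriv)

text \<open>Existence, without which the choice in \<open>corrector\<close> carries no information.
  The harmonic potential is a witness: its flux is the constant \<open>H\<close>, and derivatives of
  periodic test functions have mean zero.\<close>

lemma is_corrector_corrector:
  assumes ell: "elliptic_on (cell N) \<alpha> \<beta> A" and N: "0 < N"
  shows "is_corrector A N (corrector A N)"
proof -
  define H where "H = real N / (LINT x:cell N|lebesgue. 1 / A x)"
  obtain w where w: "periodic_H1 N w"
    and dw: "AE x in lebesgue. x \<in> cell N \<longrightarrow> weak_deriv w x = H / A x - 1"
    using harmonic_potential[OF ell N H_def] .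
  have [measurable]: "A \<in> borel_measurable lebesgue" and \<alpha>: "0 < \<alpha>"
    and ae: "AE x in lebesgue. x \<in> cell N \<longrightarrow> \<alpha> \<le> A x \<and> A x \<le> \<beta>"
    using ell by (auto simp: elliptic_on_def)
  have [measurable]: "weak_deriv w \<in> borel_measurable lebesgue"
    using w by (rule weak_deriv_measurable)
  have "(LINT x:cell N|lebesgue. A x * (weak_deriv w x + 1) * weak_deriv v x) = 0"
    if v: "periodic_H1 N v" for v
  proof -
    have [measurable]: "weak_deriv v \<in> borel_measurable lebesgue"
      using v by (rule weak_deriv_measurable)
    have "(LINT x:cell N|lebesgue. A x * (weak_deriv w x + 1) * weak_deriv v x)
        = (LINT x:cell N|lebesgue. H * weak_deriv v x)"
    proof (rule set_lebesgue_integral_cong_AE)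
      show "AE x\<in>cell N in lebesgue. A x * (weak_deriv w x + 1) * weak_deriv v x = H * weak_deriv v x"
        using dw ae by eventually_elim (use \<alpha> in auto)
    qed measurable
    then show ?thesis using periodic_H1_weak_deriv_integral_zero[OF v] by simp
  qed
  then have "is_corrector A N w" using w by (simp add: is_corrector_def)
  then show ?thesis unfolding corrector_def by (rule someI[of "is_corrector A N"])
qed

text \<open>Testing the corrector equation with the harmonic potential avoids any uniqueness statement
  for correctors.\<close>

lemma corrector_flux:
  assumes ell: "elliptic_on (cell N) \<alpha> \<beta> A" and N: "0 < N"
  shows "(LINT x:cell N|lebesgue. A x * (weak_deriv (corrector A N) x + 1))
       = (real N)\<^sup>2 / (LINT x:cell N|lebesgue. 1 / A x)"
proof -
  define H where "H = real N / (LINT x:cell N|lebesgue. 1 / A x)"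
  obtain v where v: "periodic_H1 N v"
    and dv: "AE x in lebesgue. x \<in> cell N \<longrightarrow> weak_deriv v x = H / A x - 1"
    using harmonic_potential[OF ell N H_def] .
  define p where "p = weak_deriv (corrector A N)"
  have w: "periodic_H1 N (corrector A N)"
    and test: "(LINT x:cell N|lebesgue. A x * (p x + 1) * weak_deriv v x) = 0"
    using is_corrector_corrector[OF ell N] v by (auto simp: is_corrector_def p_def)
  have [measurable]: "A \<in> borel_measurable lebesgue" and \<alpha>: "0 < \<alpha>"
    and ae: "AE x in lebesgue. x \<in> cell N \<longrightarrow> \<alpha> \<le> A x \<and> A x \<le> \<beta>"
    using ell by (auto simp: elliptic_on_def)
  have [measurable]: "weak_deriv v \<in> borel_measurable lebesgue" "p \<in> borel_measurable lebesgue"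
    unfolding p_def using v w by (blast intro: weak_deriv_measurable)+
  have int_p: "set_integrable lebesgue (cell N) (\<lambda>x. p x + 1)"
    using weak_deriv_integrable_cell[OF w] by (intro set_integral_add) (simp_all add: p_def)
  have int_flux: "set_integrable lebesgue (cell N) (\<lambda>x. A x * (p x + 1))"
  proof (rule set_integrable_bounded_mult[OF int_p])
    show "AE x in lebesgue. x \<in> cell N \<longrightarrow> \<bar>A x\<bar> \<le> \<beta>"
      using ae by eventually_elim (use \<alpha> in auto)
  qed auto
  \<comment> \<open>The factor \<open>A\<close> cancels against \<open>H / A - 1\<close>, so the
    tested equation compares the flux integral with \<open>H\<close> times the integral of
    \<open>p + 1\<close>, and the latter is \<open>N\<close> by periodicity.\<close>
  have "0 = (LINT x:cell N|lebesgue. H * (p x + 1) - A x * (p x + 1))"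
  proof -
    have "(LINT x:cell N|lebesgue. A x * (p x + 1) * weak_deriv v x)
        = (LINT x:cell N|lebesgue. H * (p x + 1) - A x * (p x + 1))"
    proof (rule set_lebesgue_integral_cong_AE)
      show "AE x\<in>cell N in lebesgue. A x * (p x + 1) * weak_deriv v x = H * (p x + 1) - A x * (p x + 1)"
        using dv ae by eventually_elim (use \<alpha> in \<open>auto simp: field_simps\<close>)
    qed measurable
    then show ?thesis using test by simp
  qed
  also have "\<dots> = H * (LINT x:cell N|lebesgue. p x + 1) - (LINT x:cell N|lebesgue. A x * (p x + 1))"
    using int_p int_flux by (subst set_integral_diff) auto
  also have "(LINT x:cell N|lebesgue. p x + 1) = real N"
    using weak_deriv_integrable_cell[OF w] periodic_H1_weak_deriv_integral_zero[OF w]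
    by (subst set_integral_add) (simp_all add: p_def)
  finally show ?thesis by (simp add: H_def p_def power2_eq_square)
qed

section \<open>Periodic media with defects\<close>

lemma set_integral_Icc_combine:
  assumes "locally_integrable f" "l \<le> m" "m \<le> r"
  shows "(LINT x:{l..r}|lebesgue. f x) = (LINT x:{l..m}|lebesgue. f x) + (LINT x:{m..r}|lebesgue. f x)"
proof -
  have "AE x in lebesgue. x \<noteq> m" by (rule AE_completion) (rule AE_lborel_singleton)
  then have "AE x in lebesgue. \<not> (x \<in> {l..m} \<and> x \<in> {m..r})"
    by eventually_elim auto
  then have "(LINT x:{l..m} \<union> {m..r}|lebesgue. f x)
      = (LINT x:{l..m}|lebesgue. f x) + (LINT x:{m..r}|lebesgue. f x)"
    using assms(1) by (intro set_integral_Un_AE) (auto intro: locally_integrable_Icc)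
  moreover have "{l..m} \<union> {m..r} = {l..r}" using assms by auto
  ultimately show ?thesis by simp
qed

lemma unit_integral_shift_nat:
  assumes "locally_integrable f" and per: "AE x in lebesgue. f (x + 1) = f x"
  shows "(LINT x:{l + real k..l + real k + 1}|lebesgue. f x) = (LINT x:{l..l + 1}|lebesgue. f x)"
proof (induction k)
  case (Suc k)
  have [measurable]: "f \<in> borel_measurable lebesgue"
    using assms(1) by (rule locally_integrable_borel_measurable)
  have "(LINT x:{l + real k + 1..l + real k + 1 + 1}|lebesgue. f x)
      = (LINT x:{l + real k..l + real k + 1}|lebesgue. f (x + 1))"
    by (rule set_lebesgue_integral_shift)
  also have "\<dots> = (LINT x:{l + real k..l + real k + 1}|lebesgue. f x)"
    by (rule set_lebesgue_integral_cong_AE) (use per in \<open>auto intro: borel_measurable_lebesgue_shift\<close>)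
  finally show ?case using Suc.IH by (simp add: add_ac)
qed simp

lemma unit_integral_shift:
  assumes "locally_integrable f" and "AE x in lebesgue. f (x + 1) = f x"
  shows "(LINT x:{of_int k - 1/2..of_int k + 1/2}|lebesgue. f x) = (LINT x:cell 1|lebesgue. f x)"
proof (cases "k \<ge> 0")
  case True
  then show ?thesis
    using unit_integral_shift_nat[OF assms, of "- (1/2)" "nat k"] by (simp add: cell_def add.commute)
next
  \<comment> \<open>For negative \<open>k\<close> the translation runs upwards from site
    \<open>k\<close> to the central cell, in \<open>- k\<close> steps.\<close>
  case False
  then show ?thesis
    using unit_integral_shift_nat[OF assms, of "of_int k - 1/2" "nat (- k)"] by (simp add: cell_def add.commute)
qed

text \<open>Passing from \<open>m\<close> to \<open>Suc m\<close> adds one unit interval, centred at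
  an integer, at each end. Periodicity is asked for only almost everywhere because weak derivatives
  have no more.\<close>

lemma periodic_integral_odd_cell:
  assumes "locally_integrable f" and "AE x in lebesgue. f (x + 1) = f x"
  shows "(LINT x:cell (2 * m + 1)|lebesgue. f x) = real (2 * m + 1) * (LINT x:cell 1|lebesgue. f x)"
proof (induction m)
  case (Suc m)
  let ?I = "\<lambda>l r. LINT x:{l..r}|lebesgue. f x"
  let ?k = "int (Suc m)"
  have "(LINT x:cell (2 * Suc m + 1)|lebesgue. f x) = ?I (of_int (- ?k) - 1/2) (of_int ?k + 1/2)"
    by (intro arg_cong[where f = "\<lambda>S. set_lebesgue_integral lebesgue S f"])
      (simp add: cell_def Icc_eq_Icc field_simps)
  also have "\<dots> = ?I (of_int (- ?k) - 1/2) (of_int (- ?k) + 1/2) + ?I (of_int (- ?k) + 1/2) (of_int ?k + 1/2)"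
    by (rule set_integral_Icc_combine[OF assms(1)]) auto
  also have "?I (of_int (- ?k) + 1/2) (of_int ?k + 1/2)
      = ?I (of_int (- ?k) + 1/2) (of_int ?k - 1/2) + ?I (of_int ?k - 1/2) (of_int ?k + 1/2)"
    by (rule set_integral_Icc_combine[OF assms(1)]) auto
  also have "?I (of_int (- ?k) + 1/2) (of_int ?k - 1/2) = (LINT x:cell (2 * m + 1)|lebesgue. f x)"
    by (intro arg_cong[where f = "\<lambda>S. set_lebesgue_integral lebesgue S f"])
      (simp add: cell_def Icc_eq_Icc field_simps)
  finally show ?case
    unfolding unit_integral_shift[OF assms] Suc.IH by (simp add: algebra_simps)
qed simp

lemma set_integral_indicator_subset:
  fixes f :: "real \<Rightarrow> real"
  assumes "S \<subseteq> T"
  shows "(LINT x:T|M. indicator S x * f x) = (LINT x:S|M. f x)"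
  unfolding set_lebesgue_integral_def
  using assms by (intro Bochner_Integration.integral_cong) (auto simp: indicator_def)

lemma locally_integrable_inverse:
  assumes "elliptic_on UNIV \<alpha> \<beta> A"
  shows "locally_integrable (\<lambda>x. 1 / A x)"
  unfolding locally_integrable_def
proof
  fix r :: real
  have [measurable]: "A \<in> borel_measurable lebesgue" and "0 < \<alpha>"
    and ae: "AE x in lebesgue. \<alpha> \<le> A x \<and> A x \<le> \<beta>"
    using assms by (auto simp: elliptic_on_def)
  have "set_integrable lebesgue {-r..r} (\<lambda>_. 1 :: real)"
    by (rule set_integrable_const_Icc)
  then have "set_integrable lebesgue {-r..r} (\<lambda>x. (1 / A x) * 1)"
  proof (rule set_integrable_bounded_mult)
    show "AE x in lebesgue. x \<in> {-r..r} \<longrightarrow> \<bar>1 / A x\<bar> \<le> 1 / \<alpha>"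
      using ae by eventually_elim (use \<open>0 < \<alpha>\<close> in \<open>auto intro: divide_left_mono\<close>)
  qed simp_all
  then show "set_integrable lebesgue {-r..r} (\<lambda>x. 1 / A x)" by simp
qed

lemma elliptic_on_subset: "elliptic_on S \<alpha> \<beta> A \<Longrightarrow> T \<subseteq> S \<Longrightarrow> elliptic_on T \<alpha> \<beta> A"
  unfolding elliptic_on_def by (auto elim!: AE_mp)

text \<open>At each point the coefficient is either \<open>a\<close> or \<open>a + c\<close>, and
  both obey the same bounds.\<close>

lemma elliptic_on_defect:
  assumes a: "elliptic_on UNIV \<alpha> \<beta> a" and ac: "elliptic_on UNIV \<alpha> \<beta> (\<lambda>x. a x + c x)"
    and c: "c \<in> borel_measurable lebesgue" and S: "S \<in> sets lebesgue"
  shows "elliptic_on T \<alpha> \<beta> (\<lambda>x. a x + indicator S x * c x)"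
proof -
  have [measurable]: "indicat_real S \<in> borel_measurable lebesgue"
    using S by (rule borel_measurable_indicator)
  have "AE x in lebesgue. \<alpha> \<le> a x \<and> a x \<le> \<beta>" "AE x in lebesgue. \<alpha> \<le> a x + c x \<and> a x + c x \<le> \<beta>"
    using a ac by (auto simp: elliptic_on_def)
  then have "AE x in lebesgue. x \<in> T \<longrightarrow> \<alpha> \<le> a x + indicator S x * c x \<and> a x + indicator S x * c x \<le> \<beta>"
    by eventually_elim (auto simp: indicator_def)
  then show ?thesis using a c by (auto simp: elliptic_on_def)
qed

text \<open>The reference flux integrates the corrector of the unit cell over a cell of length
  \<open>2 * m + 1\<close>, so the flux formula applies only after the integrand is shown to be
  1-periodic almost everywhere.\<close>

lemma flux0_eq:
  assumes ell: "elliptic_on UNIV \<alpha> \<beta> a" and per: "\<And>x. a (x + 1) = a x"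
  shows "flux0 a (2 * m + 1) = real (2 * m + 1) / (LINT x:cell 1|lebesgue. 1 / a x)"
proof -
  define w where "w = corrector a 1"
  define p where "p = weak_deriv w"
  have ell1: "elliptic_on (cell 1) \<alpha> \<beta> a" using ell by (rule elliptic_on_subset) simp
  have w: "periodic_H1 1 w"
    using is_corrector_corrector[OF ell1] by (simp add: is_corrector_def w_def)
  have wd: "has_weak_deriv w p"
    unfolding p_def by (rule periodic_H1_has_weak_deriv[OF w])
  \<comment> \<open>\<open>p\<close> and its translate are weak derivatives of the same function
    \<open>w\<close>.\<close>
  have "(\<lambda>x. w (x + 1)) = w" using w by (auto simp: periodic_H1_def)
  then have p_per: "AE x in lebesgue. p (x + 1) = p x"
    using has_weak_deriv_unique[OF _ wd] has_weak_deriv_shift[OF wd, of 1] by simp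
  have [measurable]: "a \<in> borel_measurable lebesgue" and \<alpha>: "0 < \<alpha>"
    and ae: "AE x in lebesgue. \<alpha> \<le> a x \<and> a x \<le> \<beta>"
    using ell by (auto simp: elliptic_on_def)
  have p_int: "locally_integrable p" using wd by (rule has_weak_deriv_locally_integrable)
  have [measurable]: "p \<in> borel_measurable lebesgue"
    using p_int by (rule locally_integrable_borel_measurable)
  have "locally_integrable (\<lambda>x. a x * (p x + 1))"
    unfolding locally_integrable_def
  proof
    fix r :: real
    have "set_integrable lebesgue {-r..r} (\<lambda>_. 1 :: real)"
    by (rule set_integrable_const_Icc)
    then have "set_integrable lebesgue {-r..r} (\<lambda>x. p x + 1)"
      using locally_integrable_Icc[OF p_int] by (intro set_integral_add)
    then show "set_integrable lebesgue {-r..r} (\<lambda>x. a x * (p x + 1))"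
    proof (rule set_integrable_bounded_mult)
      show "AE x in lebesgue. x \<in> {-r..r} \<longrightarrow> \<bar>a x\<bar> \<le> \<beta>"
        using ae by eventually_elim (use \<alpha> in auto)
    qed auto
  qed
  moreover have "AE x in lebesgue. a (x + 1) * (p (x + 1) + 1) = a x * (p x + 1)"
    using p_per by eventually_elim (simp add: per)
  ultimately have "flux0 a (2 * m + 1) = real (2 * m + 1) * (LINT x:cell 1|lebesgue. a x * (p x + 1))"
    unfolding flux0_def p_def w_def by (rule periodic_integral_odd_cell)
  then show ?thesis
    using corrector_flux[OF ell1] by (simp add: p_def w_def)
qed

lemma cell_1: "cell 1 = {-1/2..1/2}" "cell (Suc 0) = {-1/2..1/2}"
  by (simp_all add: cell_def)

section \<open>Fluxes of media with one and two defects\<close>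

context
  fixes a c :: "real \<Rightarrow> real" and \<alpha> \<beta> P Q :: real
  assumes c_meas [measurable]: "c \<in> borel_measurable lebesgue"
    and a_per: "\<And>x. a (x + 1) = a x" and c_per: "\<And>x. c (x + 1) = c x"
    and ell_a: "elliptic_on UNIV \<alpha> \<beta> a" and ell_ac: "elliptic_on UNIV \<alpha> \<beta> (\<lambda>x. a x + c x)"
  defines "P \<equiv> LINT x:cell 1|lebesgue. 1 / a x"
    and "Q \<equiv> LINT x:cell 1|lebesgue. 1 / (a x + c x)"
begin

text \<open>The change of \<open>1 / A\<close> caused by a defect. Defects act nonlinearly on the
  flux, but additively on the integral of \<open>1 / A\<close> as long as they overlap in null sets
  only.\<close>

definition defect_density :: "real \<Rightarrow> real" where
  "defect_density x = 1 / (a x + c x) - 1 / a x"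

lemma locally_integrable_defect_density: "locally_integrable defect_density"
  unfolding defect_density_def locally_integrable_def
  using locally_integrable_inverse[OF ell_a] locally_integrable_inverse[OF ell_ac]
  by (auto simp: locally_integrable_def)

lemma defect_density_integral:
  "(LINT x:{of_int k - 1/2..of_int k + 1/2}|lebesgue. defect_density x) = Q - P"
proof -
  have "(LINT x:{of_int k - 1/2..of_int k + 1/2}|lebesgue. defect_density x)
      = (LINT x:cell 1|lebesgue. defect_density x)"
    using locally_integrable_defect_density
    by (rule unit_integral_shift) (simp add: defect_density_def a_per c_per)
  also have "\<dots> = Q - P"
    unfolding defect_density_def P_def Q_def
    using locally_integrable_inverse[OF ell_a] locally_integrable_inverse[OF ell_ac]
    by (intro set_integral_diff set_integrable_cell)
  finally show ?thesis .
qed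

lemma inverse_integral_odd_cell:
  "(LINT x:cell (2 * m + 1)|lebesgue. 1 / a x) = real (2 * m + 1) * P"
  unfolding P_def
  by (rule periodic_integral_odd_cell[OF locally_integrable_inverse[OF ell_a]]) (simp add: a_per)

lemma defect_integrable: 
  "S \<in> sets lebesgue \<Longrightarrow> set_integrable lebesgue (cell N) (\<lambda>x. indicator S x * defect_density x)"
  using set_integrable_cell[OF locally_integrable_defect_density]
    locally_integrable_borel_measurable[OF locally_integrable_defect_density]
  by (intro set_integrable_bounded_mult[where K = 1] AE_I2) (auto simp: indicator_def)

lemma integral_inverse_defect:
  assumes S: "S \<in> sets lebesgue"
  shows "(LINT x:cell (2 * m + 1)|lebesgue. 1 / (a x + indicator S x * c x))
       = real (2 * m + 1) * P + (LINT x:cell (2 * m + 1)|lebesgue. indicator S x * defect_density x)"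
proof -
  have "1 / (a x + indicator S x * c x) = 1 / a x + indicator S x * defect_density x" for x
    by (simp add: defect_density_def indicator_def)
  then have "(LINT x:cell (2 * m + 1)|lebesgue. 1 / (a x + indicator S x * c x))
      = (LINT x:cell (2 * m + 1)|lebesgue. 1 / a x + indicator S x * defect_density x)"
    by (simp only:)
  also have "\<dots> = (LINT x:cell (2 * m + 1)|lebesgue. 1 / a x)
      + (LINT x:cell (2 * m + 1)|lebesgue. indicator S x * defect_density x)"
    by (intro set_integral_add set_integrable_cell locally_integrable_inverse[OF ell_a] defect_integrable[OF S])
  finally show ?thesis by (simp only: inverse_integral_odd_cell)
qed

text \<open>A site of the cell contributes its full unit interval: the outermost sites,
  \<open>m\<close> and \<open>- m\<close>, reach exactly to the ends of the cell.\<close>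

lemma site_in_cell:
  assumes "k \<in> sites (2 * m + 1)"
  shows "{of_int k - 1/2..of_int k + 1/2} \<subseteq> cell (2 * m + 1)"
proof -
  have "- int m \<le> k" "k \<le> int m" using assms by (auto simp: sites_def)
  then have "- real m \<le> of_int k" "of_int k \<le> real m" by linarith+
  then show ?thesis by (auto simp: cell_def field_simps)
qed

lemma flux1_eq: "flux1 a c (2 * m + 1) = (real (2 * m + 1))\<^sup>2 / (real (2 * m + 1) * P + (Q - P))"
proof -
  have "(0::int) \<in> sites (2 * m + 1)" by (simp add: sites_def)
  from site_in_cell[OF this]
  have "(LINT x:cell (2 * m + 1)|lebesgue. 1 / one_defect a c x) = real (2 * m + 1) * P + (Q - P)"
    unfolding one_defect_def
    using defect_density_integral[of 0] set_integral_indicator_subset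
    by (subst integral_inverse_defect) simp_all
  moreover have "elliptic_on (cell (2 * m + 1)) \<alpha> \<beta> (one_defect a c)"
    unfolding one_defect_def by (rule elliptic_on_defect[OF ell_a ell_ac c_meas]) simp
  ultimately show ?thesis
    using corrector_flux unfolding flux1_def by auto
qed

text \<open>The two defects overlap at most in one point, so only their number enters and the value
  does not depend on \<open>k\<close>.\<close>

lemma flux2_eq:
  assumes k: "k \<in> sites (2 * m + 1)" "k \<noteq> 0"
  shows "flux2 a c k (2 * m + 1) = (real (2 * m + 1))\<^sup>2 / (real (2 * m + 1) * P + 2 * (Q - P))"
proof -
  let ?C = "cell (2 * m + 1)"
  let ?S = "{-1/2..1/2::real}" and ?T = "{of_int k - 1/2..of_int k + 1/2::real}"
  have [measurable]: "defect_density \<in> borel_measurable lebesgue"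
    by (rule locally_integrable_borel_measurable[OF locally_integrable_defect_density])
  have "(0::int) \<in> sites (2 * m + 1)" by (simp add: sites_def)
  from site_in_cell[OF this] have S: "?S \<subseteq> ?C" by simp
  have T: "?T \<subseteq> ?C" by (rule site_in_cell[OF k(1)])
  have [measurable]: "indicat_real (?S \<union> ?T) \<in> borel_measurable lebesgue"
    by (rule borel_measurable_indicator) simp
  have "(LINT x:?C|lebesgue. indicator (?S \<union> ?T) x * defect_density x)
      = (LINT x:?C|lebesgue. indicator ?S x * defect_density x + indicator ?T x * defect_density x)"
  proof (rule set_lebesgue_integral_cong_AE)
    \<comment> \<open>For \<open>k = 1\<close> and \<open>k = -1\<close> the two intervals share an
      endpoint, where the indicator of the union is not the sum of the indicators.\<close>
    have "AE x in lebesgue. x \<noteq> (1/2 :: real)" "AE x in lebesgue. x \<noteq> (- (1/2) :: real)"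
      by (rule AE_completion, rule AE_lborel_singleton)+
    then show "AE x\<in>?C in lebesgue. indicator (?S \<union> ?T) x * defect_density x
        = indicator ?S x * defect_density x + indicator ?T x * defect_density x"
    proof eventually_elim
      case (elim x)
      have "of_int k \<le> (-1::real) \<or> of_int k \<ge> (1::real)" using k(2) by linarith
      then have "\<not> (x \<in> ?S \<and> x \<in> ?T)" using elim by auto
      then show ?case by (auto simp: indicator_def)
    qed
  qed measurable
  also have "\<dots> = (LINT x:?C|lebesgue. indicator ?S x * defect_density x)
      + (LINT x:?C|lebesgue. indicator ?T x * defect_density x)"
    by (intro set_integral_add defect_integrable) simp_all
  also have "\<dots> = 2 * (Q - P)"
    unfolding set_integral_indicator_subset[OF S] set_integral_indicator_subset[OF T]
    using defect_density_integral[of 0] defect_density_integral[of k] by simp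
  finally have "(LINT x:?C|lebesgue. 1 / two_defects a c k x) = real (2 * m + 1) * P + 2 * (Q - P)"
    unfolding two_defects_def by (subst integral_inverse_defect) simp_all
  moreover have "elliptic_on ?C \<alpha> \<beta> (two_defects a c k)"
    unfolding two_defects_def by (rule elliptic_on_defect[OF ell_a ell_ac c_meas]) simp
  ultimately show ?thesis
    using corrector_flux unfolding flux2_def by auto
qed

section \<open>Limits of the corrections\<close>

lemma P_pos: "0 < P"
  unfolding P_def using ell_a by (intro elliptic_on_inverse_integral_pos) (auto intro: elliptic_on_subset)

lemma Q_pos: "0 < Q"
  unfolding Q_def using ell_ac by (intro elliptic_on_inverse_integral_pos) (auto intro: elliptic_on_subset)

text \<open>In terms of \<open>h = 1 / N\<close> the correction is a rational function continuous at
  0. The denominators are positive because \<open>N * P + (Q - P)\<close> equals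
  \<open>(N - 1) * P + Q\<close>.\<close>

lemma first_correction_tendsto:
  "(\<lambda>m. first_correction a c (2 * m + 1)) \<longlonglongrightarrow> (P - Q) / P\<^sup>2"
proof -
  define h :: "nat \<Rightarrow> real" where "h m = 1 / real (2 * m + 1)" for m
  have h: "h \<longlonglongrightarrow> 0" unfolding h_def by real_asymp
  have "first_correction a c (2 * m + 1) = (P - Q) / (P * (P - (P - Q) * h m))" for m
  proof -
    define n where "n = real (2 * m + 1)"
    have "1 \<le> n" by (simp add: n_def)
    then have "0 \<le> (n - 1) * P" using P_pos by simp
    then have pos: "0 < n * P + (Q - P)" using Q_pos by (simp add: algebra_simps)
    have "h m = 1 / n" by (simp add: h_def n_def)
    then have eq: "P - (P - Q) * h m = (n * P + (Q - P)) / n"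
      using \<open>1 \<le> n\<close> by (simp add: field_simps)
    have "first_correction a c (2 * m + 1) = n\<^sup>2 / (n * P + (Q - P)) - n / P"
      unfolding first_correction_def flux1_eq flux0_eq[OF ell_a a_per] P_def n_def ..
    also have "\<dots> = (P - Q) / (P * ((n * P + (Q - P)) / n))"
      using pos P_pos \<open>1 \<le> n\<close> by (simp add: field_simps power2_eq_square)
    finally show ?thesis by (simp add: eq)
  qed
  moreover have "(\<lambda>m. (P - Q) / (P * (P - (P - Q) * h m))) \<longlonglongrightarrow> (P - Q) / (P * (P - (P - Q) * 0))"
    using P_pos by (intro tendsto_intros h) auto
  ultimately show ?thesis by (simp add: power2_eq_square)
qed

lemma second_correction_tendsto:
  "(\<lambda>m. second_correction a c (2 * m + 1)) \<longlonglongrightarrow> (P - Q)\<^sup>2 / P ^ 3"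
proof -
  define h :: "nat \<Rightarrow> real" where "h m = 1 / real (2 * m + 1)" for m
  have h: "h \<longlonglongrightarrow> 0" unfolding h_def by real_asymp
  let ?r = "\<lambda>t. (1 - t) * (P - Q)\<^sup>2 / (P * ((P - 2 * (P - Q) * t) * (P - (P - Q) * t)))"
  \<comment> \<open>With \<open>m \<ge> 1\<close> the length is at least 3, and the two-defect
    denominator, \<open>(n - 2) * P + 2 * Q\<close>, is positive; length 1 would leave its sign
    open.\<close>
  have "second_correction a c (2 * m + 1) = ?r (h m)" if "m \<ge> 1" for m
  proof -
    define n where "n = real (2 * m + 1)"
    have "3 \<le> n" using that by (simp add: n_def)
    then have "0 \<le> (n - 2) * P" using P_pos by simp
    then have pos2: "0 < n * P + 2 * (Q - P)" using Q_pos by (simp add: algebra_simps)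
    have "0 \<le> (n - 1) * P" using P_pos \<open>3 \<le> n\<close> by simp
    then have pos1: "0 < n * P + (Q - P)" using Q_pos by (simp add: algebra_simps)
    have hm: "h m = 1 / n" by (simp add: h_def n_def)
    have eq1: "P - (P - Q) * h m = (n * P + (Q - P)) / n"
      and eq2: "P - 2 * (P - Q) * h m = (n * P + 2 * (Q - P)) / n"
      and eq0: "1 - h m = (n - 1) / n"
      using \<open>3 \<le> n\<close> by (simp_all add: hm field_simps)
    have card: "card (sites (2 * m + 1) - {0}) = 2 * m"
      by (simp add: sites_def nat_add_distrib nat_mult_distrib)
    have "flux2 a c k (2 * m + 1) - 2 * flux1 a c (2 * m + 1) + flux0 a (2 * m + 1)
        = n\<^sup>2 / (n * P + 2 * (Q - P)) - 2 * (n\<^sup>2 / (n * P + (Q - P))) + n / P"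
      if "k \<in> sites (2 * m + 1) - {0}" for k
      using that flux2_eq[of k m]
      unfolding flux1_eq flux0_eq[OF ell_a a_per] P_def n_def by simp
    then have "second_correction a c (2 * m + 1)
        = 1 / 2 * ((n - 1) * (n\<^sup>2 / (n * P + 2 * (Q - P)) - 2 * (n\<^sup>2 / (n * P + (Q - P))) + n / P))"
      unfolding second_correction_def by (simp only: sum.cong sum_constant card) (simp add: n_def)
    also have "n\<^sup>2 / (n * P + 2 * (Q - P)) - 2 * (n\<^sup>2 / (n * P + (Q - P))) + n / P
        = 2 * n * (P - Q)\<^sup>2 / (P * ((n * P + 2 * (Q - P)) * (n * P + (Q - P))))"
    proof -
      \<comment> \<open>The denominators are kept as atoms \<open>u\<close> and \<open>v\<close>
        while fractions are cleared; their values enter only in the resulting polynomial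
        identity.\<close>
      have "u \<noteq> 0 \<Longrightarrow> v \<noteq> 0 \<Longrightarrow> u = n * P - 2 * d \<Longrightarrow> v = n * P - d \<Longrightarrow>
        n\<^sup>2 / u - 2 * (n\<^sup>2 / v) + n / P = 2 * n * d\<^sup>2 / (P * (u * v))" for u v d
        using P_pos by (simp add: divide_simps) (simp add: algebra_simps power2_eq_square)
      from this[of "n * P + 2 * (Q - P)" "n * P + (Q - P)" "P - Q"] pos1 pos2
      show ?thesis by (simp add: algebra_simps)
    qed
    also have "1 / 2 * ((n - 1) * (2 * n * (P - Q)\<^sup>2 / (P * ((n * P + 2 * (Q - P)) * (n * P + (Q - P))))))
        = (n - 1) / n * (P - Q)\<^sup>2 / (P * (((n * P + 2 * (Q - P)) / n) * ((n * P + (Q - P)) / n)))"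
      using \<open>3 \<le> n\<close> by simp
    finally show ?thesis by (simp only: eq0 eq1 eq2)
  qed
  then have "eventually (\<lambda>m. ?r (h m) = second_correction a c (2 * m + 1)) sequentially"
    by (intro eventually_sequentiallyI[of 1]) simp
  moreover have "(\<lambda>m. ?r (h m)) \<longlonglongrightarrow> ?r 0"
    using P_pos by (intro tendsto_intros h) auto
  ultimately have "(\<lambda>m. second_correction a c (2 * m + 1)) \<longlonglongrightarrow> ?r 0"
    by (rule Lim_transform_eventually[rotated])
  then show ?thesis by (simp add: power2_eq_square power3_eq_cube mult.assoc)
qed

end

section \<open>The random medium\<close>

text \<open>The closed site intervals meet at half-integers, where two summands may be nonzero;
  strictly inside the unit cell the sum reduces to one term.\<close>

lemma random_defects_interior:
  assumes "x \<in> {-1/2<..<1/2}"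
  shows "random_defects B x \<omega> = B 0 \<omega>"
proof -
  have "indicator {of_int k - 1/2..of_int k + 1/2} x * B k \<omega> = 0" if "k \<noteq> 0" for k :: int
  proof -
    have "of_int k \<le> (-1::real) \<or> of_int k \<ge> (1::real)" using that by linarith
    then show ?thesis using assms by (auto simp: indicator_def)
  qed
  then have "random_defects B x \<omega>
      = (\<Sum>\<^sub>\<infinity>k\<in>{0}. indicator {of_int k - 1/2..of_int k + 1/2} x * B k \<omega>)"
    unfolding random_defects_def by (intro infsum_cong_neutral) auto
  then show ?thesis using assms by (simp add: indicator_def)
qed

text \<open>Almost everywhere in the unit cell only the site \<open>0\<close> matters, so the homogenised coefficient
  is determined by the law of a single Bernoulli variable.\<close>

lemma hom_random_bernoulli:
  assumes a [measurable]: "a \<in> borel_measurable lebesgue" and c [measurable]: "c \<in> borel_measurable lebesgue"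
    and "bernoulli_family M \<eta> B"
  shows "hom_random M B a c = inverse ((1 - \<eta>) * (LINT x:cell 1|lebesgue. 1 / a x)
       + \<eta> * (LINT x:cell 1|lebesgue. 1 / (a x + c x)))"
proof -
  interpret prob_space M using assms(3) by (simp add: bernoulli_family_def)
  have "indep_vars (\<lambda>_. borel) B UNIV" using assms(3) by (simp add: bernoulli_family_def)
  then have B[measurable]: "B 0 \<in> borel_measurable M" by (simp add: indep_vars_def)
  define E1 where "E1 = {\<omega> \<in> space M. B 0 \<omega> = 1}"
  define E0 where "E0 = {\<omega> \<in> space M. B 0 \<omega> = 0}"
  have E_sets[measurable]: "E1 \<in> sets M" "E0 \<in> sets M" unfolding E1_def E0_def by measurable
  have probs: "prob E1 = \<eta>" "prob E0 = 1 - \<eta>"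
    using assms(3) by (simp_all add: bernoulli_family_def E1_def E0_def)
  \<comment> \<open>Only two probabilities are prescribed, not the range of \<open>B 0\<close>. They
    add up to 1, so all other values form a null event.\<close>
  have "prob (E1 \<union> E0) = 1"
    using probs by (subst finite_measure_Union) (auto simp: E1_def E0_def)
  then have ae_B: "AE \<omega> in M. \<omega> \<in> E1 \<union> E0"
    by (subst (asm) prob_eq_1) simp_all
  define G where "G t = (LINT x:{-1/2..1/2}|lebesgue. 1 / (a x + t * c x))" for t :: real
  \<comment> \<open>Measurability of \<open>G\<close> in its parameter rests on joint measurability
    of the integrand in \<open>(t, x)\<close>, which Borel versions of \<open>a\<close> and
    \<open>c\<close> provide.\<close>
  obtain a' where [measurable]: "a' \<in> borel_measurable borel" and a': "AE x in lborel. a x = a' x"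
    using completion_ex_borel_measurable_real[OF a] by auto
  obtain c' where [measurable]: "c' \<in> borel_measurable borel" and c': "AE x in lborel. c x = c' x"
    using completion_ex_borel_measurable_real[OF c] by auto
  have [measurable]: "a' \<in> borel_measurable lebesgue" "c' \<in> borel_measurable lebesgue"
    by (intro measurable_completion; simp)+
  have "G t = (LINT x|lborel. indicator {-1/2..1/2} x * (1 / (a' x + t * c' x)))" for t
  proof -
    have "G t = (LINT x|lebesgue. indicator {-1/2..1/2} x * (1 / (a' x + t * c' x)))"
      unfolding G_def set_lebesgue_integral_def
    proof (rule integral_cong_AE)
      show "AE x in lebesgue. indicator {-1/2..1/2} x *\<^sub>R (1 / (a x + t * c x))
          = indicator {-1/2..1/2} x * (1 / (a' x + t * c' x))"
        using AE_completion[OF a'] AE_completion[OF c'] by eventually_elim simp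
    qed measurable
    then show ?thesis by (simp add: integral_completion)
  qed
  moreover have "(\<lambda>t. LINT x|lborel. indicator {-1/2..1/2} x * (1 / (a' x + t * c' x))) \<in> borel_measurable borel"
    by measurable
  ultimately have G_meas [measurable]: "G \<in> borel_measurable borel" by presburger
  have meas_t: "(\<lambda>x. indicator {-1/2..1/2} x *\<^sub>R (1 / (a x + t * c x))) \<in> borel_measurable lebesgue" for t
    by measurable
  have G_B: "(LINT x:{-1/2..1/2}|lebesgue. 1 / (a x + random_defects B x \<omega> * c x)) = G (B 0 \<omega>)" for \<omega>
    unfolding G_def set_lebesgue_integral_def
  proof (rule integral_cong_AE)
    have "AE x in lebesgue. x \<noteq> (1/2 :: real)" "AE x in lebesgue. x \<noteq> (- (1/2) :: real)"
      by (rule AE_completion, rule AE_lborel_singleton)+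
    then show eq: "AE x in lebesgue. indicator {-1/2..1/2} x *\<^sub>R (1 / (a x + random_defects B x \<omega> * c x))
        = indicator {-1/2..1/2} x *\<^sub>R (1 / (a x + B 0 \<omega> * c x))"
    proof eventually_elim
      case (elim x)
      then show ?case
        using random_defects_interior[of x B \<omega>] by (cases "x \<in> {-1/2..1/2}") auto
    qed
    show meas: "(\<lambda>x. indicator {-1/2..1/2} x *\<^sub>R (1 / (a x + B 0 \<omega> * c x))) \<in> borel_measurable lebesgue"
      by (rule meas_t)
    \<comment> \<open>Completeness of Lebesgue measure transfers measurability along
      almost-everywhere equality, so \<open>random_defects\<close> need not be analysed at the
      endpoints.\<close>
    show "(\<lambda>x. indicator {-1/2..1/2} x *\<^sub>R (1 / (a x + random_defects B x \<omega> * c x)))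
        \<in> borel_measurable lebesgue"
      by (rule borel_measurable_AE[OF meas AE_symmetric[OF eq]])
  qed
  have "(LINT \<omega>|M. G (B 0 \<omega>)) = (LINT \<omega>|M. G 1 * indicator E1 \<omega> + G 0 * indicator E0 \<omega>)"
  proof (rule integral_cong_AE)
    show "AE \<omega> in M. G (B 0 \<omega>) = G 1 * indicator E1 \<omega> + G 0 * indicator E0 \<omega>"
      using ae_B by eventually_elim (auto simp: E1_def E0_def)
  qed measurable
  also have "\<dots> = G 1 * \<eta> + G 0 * (1 - \<eta>)"
  proof -
    have "integrable M (indicat_real E1)" "integrable M (indicat_real E0)"
      using E_sets by (simp_all add: integrable_real_indicator less_top[symmetric])
    then show ?thesis using probs E_sets by (simp add: Bochner_Integration.integral_add)
  qed
  finally show ?thesis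
    unfolding hom_random_def G_B by (simp add: G_def cell_1 algebra_simps)
qed

text \<open>With R = P - \<eta> D, the terms up to second order are a finite geometric sum, and the
  remainder is exactly (\<eta> D)^3 / (P^3 R). As a convex combination of \<open>P\<close> and
  \<open>Q\<close>, R is at least \<open>min P Q\<close>; this gives the constant
  \<open>C\<close>.\<close>

lemma inverse_affine_expansion:
  fixes P Q :: real
  assumes "0 < P" "0 < Q"
  shows "(\<lambda>\<eta>. inverse ((1 - \<eta>) * P + \<eta> * Q)
      - (inverse P + \<eta> * ((P - Q) / P\<^sup>2) + \<eta>\<^sup>2 * ((P - Q)\<^sup>2 / P ^ 3)))
    \<in> O[at 0 within {0..1}](\<lambda>\<eta>. \<eta> ^ 3)"
proof (rule bigoI)
  define C where "C = \<bar>P - Q\<bar> ^ 3 / (P ^ 3 * min P Q)"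
  have "norm (inverse ((1 - \<eta>) * P + \<eta> * Q)
      - (inverse P + \<eta> * ((P - Q) / P\<^sup>2) + \<eta>\<^sup>2 * ((P - Q)\<^sup>2 / P ^ 3))) \<le> C * norm (\<eta> ^ 3)"
    if "\<eta> \<in> {0..1}" for \<eta>
  proof -
    define R where "R = (1 - \<eta>) * P + \<eta> * Q"
    have "(1 - \<eta>) * min P Q + \<eta> * min P Q \<le> R"
      unfolding R_def using that by (intro add_mono mult_left_mono) auto
    then have R: "min P Q \<le> R" by (simp add: algebra_simps)
    then have "0 < R" using assms by linarith
    have D: "\<eta> * (P - Q) = P - R" by (simp add: R_def algebra_simps)
    have "inverse R - (inverse P + \<eta> * ((P - Q) / P\<^sup>2) + \<eta>\<^sup>2 * ((P - Q)\<^sup>2 / P ^ 3))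
        = inverse R - (inverse P + (\<eta> * (P - Q)) / P\<^sup>2 + (\<eta> * (P - Q))\<^sup>2 / P ^ 3)"
      by (simp add: power_mult_distrib)
    also have "\<dots> = (\<eta> * (P - Q)) ^ 3 / (P ^ 3 * R)"
      unfolding D using \<open>0 < R\<close> \<open>0 < P\<close>
      by (simp add: divide_simps) (simp add: algebra_simps power2_eq_square power3_eq_cube)
    finally have "norm (inverse R - (inverse P + \<eta> * ((P - Q) / P\<^sup>2) + \<eta>\<^sup>2 * ((P - Q)\<^sup>2 / P ^ 3)))
        = \<bar>\<eta> * (P - Q)\<bar> ^ 3 / (P ^ 3 * R)"
      using \<open>0 < R\<close> \<open>0 < P\<close> by (simp add: abs_divide abs_mult power_abs)
    also have "\<dots> \<le> \<bar>\<eta> * (P - Q)\<bar> ^ 3 / (P ^ 3 * min P Q)"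
      using R \<open>0 < R\<close> assms by (intro divide_left_mono mult_left_mono mult_pos_pos) auto
    also have "\<dots> = C * norm (\<eta> ^ 3)"
      by (simp add: C_def abs_mult power_mult_distrib power_abs)
    finally show ?thesis by (simp add: R_def)
  qed
  then show "eventually (\<lambda>\<eta>. norm (inverse ((1 - \<eta>) * P + \<eta> * Q)
      - (inverse P + \<eta> * ((P - Q) / P\<^sup>2) + \<eta>\<^sup>2 * ((P - Q)\<^sup>2 / P ^ 3))) \<le> C * norm (\<eta> ^ 3))
    (at 0 within {0..1})"
    by (auto simp: eventually_at_filter)
qed

theorem proposition5:
  fixes a c :: "real \<Rightarrow> real" and \<alpha> \<beta> :: real
    and M :: "real \<Rightarrow> 'a measure" and B :: "real \<Rightarrow> int \<Rightarrow> 'a \<Rightarrow> real"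
  assumes "a \<in> borel_measurable lebesgue" and "c \<in> borel_measurable lebesgue"
    and "\<And>x. a (x + 1) = a x" and "\<And>x. c (x + 1) = c x"
    and "0 < \<alpha>" and "\<alpha> \<le> \<beta>"
    and "AE x in lebesgue. \<alpha> \<le> a x \<and> a x \<le> \<beta>"
    and "AE x in lebesgue. \<alpha> \<le> a x + c x \<and> a x + c x \<le> \<beta>"
    and "\<And>\<eta>. \<eta> \<in> {0..1} \<Longrightarrow> bernoulli_family (M \<eta>) \<eta> (B \<eta>)"
  shows "\<exists>a1 a2.
    (\<lambda>m. first_correction a c (2 * m + 1)) \<longlonglongrightarrow> a1 \<and>
    (\<lambda>m. second_correction a c (2 * m + 1)) \<longlonglongrightarrow> a2 \<and>
    (\<lambda>\<eta>. hom_random (M \<eta>) (B \<eta>) a c - (hom_periodic a + \<eta> * a1 + \<eta>\<^sup>2 * a2))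
      \<in> O[at 0 within {0..1}](\<lambda>\<eta>. \<eta> ^ 3)"
proof -
  define P where "P = (LINT x:cell 1|lebesgue. 1 / a x)"
  define Q where "Q = (LINT x:cell 1|lebesgue. 1 / (a x + c x))"
  have ell_a: "elliptic_on UNIV \<alpha> \<beta> a" and ell_ac: "elliptic_on UNIV \<alpha> \<beta> (\<lambda>x. a x + c x)"
    using assms by (simp_all add: elliptic_on_def)
  note facts = assms(2-4) ell_a ell_ac
  have pos: "0 < P" "0 < Q"
    unfolding P_def Q_def by (rule P_pos[OF facts] Q_pos[OF facts])+
  have lims: "(\<lambda>m. first_correction a c (2 * m + 1)) \<longlonglongrightarrow> (P - Q) / P\<^sup>2"
    "(\<lambda>m. second_correction a c (2 * m + 1)) \<longlonglongrightarrow> (P - Q)\<^sup>2 / P ^ 3"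
    unfolding P_def Q_def by (rule first_correction_tendsto[OF facts] second_correction_tendsto[OF facts])+
  have hom: "hom_periodic a = inverse P"
    by (simp add: hom_periodic_def P_def cell_1)
  \<comment> \<open>The probability space may change with \<open>\<eta>\<close> and is constrained
    only on \<open>{0..1}\<close>; there the random coefficient equals the deterministic expression,
    which suffices for a limit within that interval.\<close>
  have "eventually (\<lambda>\<eta>. inverse ((1 - \<eta>) * P + \<eta> * Q)
        - (inverse P + \<eta> * ((P - Q) / P\<^sup>2) + \<eta>\<^sup>2 * ((P - Q)\<^sup>2 / P ^ 3))
      = hom_random (M \<eta>) (B \<eta>) a c
        - (hom_periodic a + \<eta> * ((P - Q) / P\<^sup>2) + \<eta>\<^sup>2 * ((P - Q)\<^sup>2 / P ^ 3))) (at 0 within {0..1})"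
    using hom_random_bernoulli[OF assms(1,2) assms(9)]
    by (auto simp: eventually_at_filter P_def Q_def hom[unfolded P_def])
  then have "(\<lambda>\<eta>. hom_random (M \<eta>) (B \<eta>) a c
        - (hom_periodic a + \<eta> * ((P - Q) / P\<^sup>2) + \<eta>\<^sup>2 * ((P - Q)\<^sup>2 / P ^ 3)))
      \<in> O[at 0 within {0..1}](\<lambda>\<eta>. \<eta> ^ 3)"
    using inverse_affine_expansion[OF pos] by (rule landau_o.big.in_cong[THEN iffD1])
  with lims show ?thesis by blast
qed

end
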